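(* Let $k\ge 0$ be a fixed integer and let $c_{k,n}$ be the number of compacted trees of size $n$ with right height at most $k$. Then there is a constant $\kappa_k\in\mathbb{R}$, independent of $n$, such that, as $n\to\infty$, $$ c_{k,n}\sim \kappa_k\, n!\,\left(4\cos^2\!\left(\frac{\pi}{k+3}\right)\right)^{n} n^{-\frac{k}{2}-\frac{1}{k+3}-\left(\frac14-\frac{1}{k+3}\right)\frac{1}{\cos^2\left(\frac{\pi}{k+3}\right)}}. $$
   Context: A full binary tree is a rooted plane tree in which every node has either $0$ or $2$ ordered (left, right) children; a fringe subtree is a node together with all its descendants. The compacted tree of a full binary tree $T$ is the directed acyclic graph obtained by traversing $T$ in post-order (left subtree, right subtree, node) and, whenever the fringe subtree at a node equals a fringe subtree already seen earlier in the traversal, deleting that duplicate and replacing the edge from its parent to it by a pointer to the earlier occurrence. Distinct full binary trees give distinct compacted trees; the size of the compacted tree is its number of internal nodes, which equals the number of distinct fringe subtrees of $T$ that are not a single leaf. The spine of a compacted tree is the binary tree obtained by removing all pointers and the leaf. The level of a spine node is the number of right edges on the spine path from the root to it; the right height is the maximal level of a spine node. *)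

theory Defs
  imports Complex_Main "HOL-Library.Tree" "HOL-Library.Landau_Symbols"
begin

text \<open>
  Full binary trees are rendered as \<open>unit tree\<close>: \<open>\<langle>\<rangle>\<close> is a leaf and \<open>\<langle>l, (), r\<rangle>\<close> an internal node
  with left child \<open>l\<close> and right child \<open>r\<close>.  The fringe subtrees of \<open>t\<close> are \<open>subtrees t\<close>.
\<close>

type_synonym full_tree = "unit tree"

text \<open>
  A compacted tree is a rooted plane directed acyclic graph.  It is written as the term that
  unfolds it along the edges that are not pointers; \<open>Pointer i\<close> is a pointer to the \<open>i\<close>-th retained
  vertex in post-order, counted from 0 and including the unique leaf.
\<close>

datatype compacted = CLeaf | CNode compacted compacted | Pointer nat

definition position :: "'a \<Rightarrow> 'a list \<Rightarrow> nat" where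
  "position x xs = length (takeWhile (\<lambda>y. y \<noteq> x) xs)"

definition visit :: "full_tree \<Rightarrow> compacted \<Rightarrow> full_tree list \<Rightarrow> compacted \<times> full_tree list" where
  "visit t c seen = (if t \<in> set seen then (Pointer (position t seen), seen) else (c, seen @ [t]))"

text \<open>
  The list holds the distinct fringe subtrees met so far in the post-order traversal, in order of
  first occurrence.
\<close>

primrec traverse :: "full_tree \<Rightarrow> full_tree list \<Rightarrow> compacted \<times> full_tree list" where
  "traverse \<langle>\<rangle> seen = visit \<langle>\<rangle> CLeaf seen"
| "traverse \<langle>l, a, r\<rangle> seen =
    (let (l', seen1) = traverse l seen;
         (r', seen2) = traverse r seen1
     in visit \<langle>l, a, r\<rangle> (CNode l' r') seen2)"

definition compact :: "full_tree \<Rightarrow> compacted" where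
  "compact t = fst (traverse t [])"

primrec csize :: "compacted \<Rightarrow> nat" where
  "csize CLeaf = 0"
| "csize (CNode l r) = Suc (csize l + csize r)"
| "csize (Pointer i) = 0"

text \<open>The spine is a binary tree, not necessarily full; here \<open>\<langle>\<rangle>\<close> stands for an absent child.\<close>

primrec spine :: "compacted \<Rightarrow> unit tree" where
  "spine CLeaf = \<langle>\<rangle>"
| "spine (CNode l r) = \<langle>spine l, (), spine r\<rangle>"
| "spine (Pointer i) = \<langle>\<rangle>"

primrec levels :: "'a tree \<Rightarrow> nat set" where
  "levels \<langle>\<rangle> = {}"
| "levels \<langle>l, a, r\<rangle> = {0} \<union> levels l \<union> Suc ` levels r"

text \<open>The root has level 0, so inserting 0 only matters for the empty spine (size 0).\<close>

definition right_height :: "'a tree \<Rightarrow> nat" where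
  "right_height s = Max (insert 0 (levels s))"

definition bounded_compacted :: "nat \<Rightarrow> nat \<Rightarrow> compacted set" where
  "bounded_compacted k n = {C \<in> range compact. csize C = n \<and> right_height (spine C) \<le> k}"

definition compacted_count :: "nat \<Rightarrow> nat \<Rightarrow> nat" where
  "compacted_count k n = card (bounded_compacted k n)"

text \<open>
  The size is the number of distinct fringe subtrees other than the leaf; in particular there are
  finitely many compacted trees of each size.
\<close>

lemma traverse_spec:
  assumes "distinct seen" "\<forall>u \<in> set seen. subtrees u \<subseteq> set seen" "traverse t seen = (c, seen')"
  shows "distinct seen' \<and> set seen' = set seen \<union> subtrees t \<and>
         csize c = card (subtrees t - set seen - {\<langle>\<rangle>})"
  using assms
proof (induction t arbitrary: seen c seen')
  case Leaf
  then show ?case by (auto simp: visit_def insert_Diff_if split: if_splits)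
next
  case (Node l a r)
  obtain l' s1 where 1: "traverse l seen = (l', s1)" by fastforce
  obtain r' s2 where 2: "traverse r s1 = (r', s2)" by fastforce
  have sub: "subtrees u \<subseteq> subtrees t" if "u \<in> subtrees t" for u t :: full_tree
    using that by (induction t) auto
  have A: "distinct s1" "set s1 = set seen \<union> subtrees l"
      "csize l' = card (subtrees l - set seen - {\<langle>\<rangle>})"
    using Node.IH(1)[OF Node.prems(1,2) 1] by auto
  have cl1: "\<forall>u \<in> set s1. subtrees u \<subseteq> set s1"
    unfolding A using Node.prems(2) sub by blast
  have B: "distinct s2" "set s2 = set s1 \<union> subtrees r"
      "csize r' = card (subtrees r - set s1 - {\<langle>\<rangle>})"
    using Node.IH(2)[OF A(1) cl1 2] by auto
  have fin: "finite (subtrees u)" for u :: full_tree by (induction u) auto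
  have sz: "size u \<le> size t" if "u \<in> subtrees t" for u t :: full_tree
    using that by (induction t) auto
  have nin: "\<langle>l, a, r\<rangle> \<notin> subtrees l" "\<langle>l, a, r\<rangle> \<notin> subtrees r"
    using sz by fastforce+
  have self: "t \<in> subtrees t" for t :: full_tree by (cases t) auto
  have eq: "traverse \<langle>l, a, r\<rangle> seen = visit \<langle>l, a, r\<rangle> (CNode l' r') s2"
    using 1 2 by simp
  show ?case
  proof (cases "\<langle>l, a, r\<rangle> \<in> set seen")
    case True
    then have "subtrees \<langle>l, a, r\<rangle> \<subseteq> set seen" using Node.prems(2) by blast
    then show ?thesis using eq Node.prems(3) A B
      by (auto simp: visit_def Diff_eq_empty_iff[THEN iffD2] split: if_splits)
  next
    case False
    then have n2: "\<langle>l, a, r\<rangle> \<notin> set s2" using A B nin by auto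
    have c: "c = CNode l' r'" "seen' = s2 @ [\<langle>l, a, r\<rangle>]"
      using eq n2 Node.prems(3) by (auto simp: visit_def)
    have "subtrees \<langle>l, a, r\<rangle> - set seen - {\<langle>\<rangle>} =
        insert \<langle>l, a, r\<rangle> ((subtrees l - set seen - {\<langle>\<rangle>}) \<union> (subtrees r - set s1 - {\<langle>\<rangle>}))"
      using A(2) False by auto
    moreover have "card ((subtrees l - set seen - {\<langle>\<rangle>}) \<union> (subtrees r - set s1 - {\<langle>\<rangle>})) =
        csize l' + csize r'"
      unfolding A(3) B(3) using A(2) fin by (intro card_Un_disjoint) auto
    ultimately show ?thesis
      using c A(2) B n2 nin fin by (auto simp: card_insert_if)
  qed
qed

lemma csize_compact: "csize (compact t) = card (subtrees t - {\<langle>\<rangle>})"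
  using traverse_spec[of "[]" t "fst (traverse t [])" "snd (traverse t [])"]
  by (simp add: compact_def)

lemma height_le_csize_compact: "height t \<le> csize (compact t)"
proof -
  have fin: "finite (subtrees u)" for u :: full_tree by (induction u) auto
  have sz: "size u \<le> size t" if "u \<in> subtrees t" for u t :: full_tree
    using that by (induction t) auto
  have "height t \<le> card (subtrees t - {\<langle>\<rangle>})" for t :: full_tree
  proof (induction t)
    case (Node l a r)
    have "Suc (card (subtrees s - {\<langle>\<rangle>})) \<le> card (subtrees \<langle>l, a, r\<rangle> - {\<langle>\<rangle>})" if "s = l \<or> s = r" for s
    proof -
      have "\<langle>l, a, r\<rangle> \<notin> subtrees s" using sz that by fastforce
      then have "Suc (card (subtrees s - {\<langle>\<rangle>})) = card (insert \<langle>l, a, r\<rangle> (subtrees s - {\<langle>\<rangle>}))"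
        using fin by simp
      also have "\<dots> \<le> card (subtrees \<langle>l, a, r\<rangle> - {\<langle>\<rangle>})"
        using fin that by (intro card_mono) auto
      finally show ?thesis .
    qed
    from this[of l] this[of r] Node.IH show ?case by (auto simp: max_def)
  qed simp
  then show ?thesis by (simp add: csize_compact)
qed

lemma finite_bounded_compacted: "finite (bounded_compacted k n)"
proof -
  have "finite {t :: full_tree. height t \<le> h}" for h
  proof (induction h)
    case (Suc h)
    have "{t :: full_tree. height t \<le> Suc h} \<subseteq>
        insert \<langle>\<rangle> ((\<lambda>(l, r). \<langle>l, (), r\<rangle>) ` ({t. height t \<le> h} \<times> {t. height t \<le> h}))"
    proof
      fix t :: full_tree
      assume "t \<in> {t. height t \<le> Suc h}"
      then show "t \<in> insert \<langle>\<rangle> ((\<lambda>(l, r). \<langle>l, (), r\<rangle>) ` ({t. height t \<le> h} \<times> {t. height t \<le> h}))"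
        by (cases t) auto
    qed
    then show ?case using Suc by (meson finite_SigmaI finite_imageI finite_insert finite_subset)
  qed simp
  moreover have "bounded_compacted k n \<subseteq> compact ` {t. height t \<le> n}"
    unfolding bounded_compacted_def using height_le_csize_compact by auto
  ultimately show ?thesis by (meson finite_imageI finite_subset)
qed

end

theory Submission
  imports Defs "HOL-Real_Asymp.Real_Asymp" "HOL-Analysis.Summation_Tests"
begin

text \<open>
  Following the level of the most recently completed node through the post-order traversal turns
  the count into a linear recurrence for vectors of length \<open>k + 1\<close>.  Divided by \<open>p! * p ^ j\<close> its
  step matrix is \<open>A + B / p + O(1 / p\<^sup>2)\<close>, where \<open>A\<close> has ones on and below the first superdiagonal.
  The Perron vectors of \<open>A\<close> are explicit in sines of multiples of \<open>\<phi> = \<pi> / (k + 3)\<close>, its Perron root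
  is \<open>\<lambda> = 4 cos\<^sup>2 \<phi>\<close>, and \<open>u B w / (\<lambda> u w)\<close>, with \<open>u\<close> and \<open>w\<close> the left and right Perron vectors, is
  the claimed exponent \<open>\<theta>\<close> of \<open>n\<close>.  Dividing by a corrected eigenvector \<open>w + x / p\<close> and by
  \<open>\<lambda> ^ p * p powr \<theta>\<close> makes the step matrices nonnegative with row sums \<open>1 + O(1 / p\<^sup>2)\<close>.  Such
  products of nearly stochastic matrices contract oscillation, so all entries converge to a common
  positive limit.
\<close>

section \<open>New trees relative to the trees already seen\<close>

lemma self_in_subtrees: "t \<in> subtrees t"
  by (cases t) auto

lemma subtrees_trans: "u \<in> subtrees t \<Longrightarrow> subtrees u \<subseteq> subtrees t"
  by (induction t) auto

lemma finite_subtrees: "finite (subtrees t)"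
  by (induction t) auto

lemma size_le_subtrees: "u \<in> subtrees t \<Longrightarrow> size u \<le> size t"
  by (induction t) auto

lemma node_notin_subtrees: "\<langle>l, a, r\<rangle> \<notin> subtrees l" "\<langle>l, a, r\<rangle> \<notin> subtrees r"
  using size_le_subtrees by fastforce+

lemma finite_levels: "finite (levels t)"
  by (induction t) auto

lemma nth_position: "x \<in> set xs \<Longrightarrow> xs ! position x xs = x"
  by (induction xs) (auto simp: position_def)

definition subtree_closed :: "full_tree set \<Rightarrow> bool" where
  "subtree_closed S \<longleftrightarrow> (\<forall>u\<in>S. subtrees u \<subseteq> S)"

lemma subtree_closedD: "subtree_closed S \<Longrightarrow> t \<in> S \<Longrightarrow> u \<in> subtrees t \<Longrightarrow> u \<in> S"
  by (auto simp: subtree_closed_def)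

lemma subtree_closed_node: "subtree_closed S \<Longrightarrow> \<langle>l, a, r\<rangle> \<in> S \<Longrightarrow> l \<in> S \<and> r \<in> S"
  using subtree_closedD[of S "\<langle>l, a, r\<rangle>" l] subtree_closedD[of S "\<langle>l, a, r\<rangle>" r]
  by (simp add: self_in_subtrees)

lemma subtree_closed_Un: "subtree_closed S \<Longrightarrow> subtree_closed (S \<union> subtrees t)"
  using subtrees_trans by (fastforce simp: subtree_closed_def)

lemma snd_traverse:
  assumes "distinct seen" "subtree_closed (set seen)"
  shows "distinct (snd (traverse t seen))" "set (snd (traverse t seen)) = set seen \<union> subtrees t"
  using traverse_spec[OF assms(1) assms(2)[unfolded subtree_closed_def], of t
      "fst (traverse t seen)" "snd (traverse t seen)"] by simp_all

lemma traverse_seen: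
  assumes "distinct seen" "subtree_closed (set seen)" "t \<in> set seen"
  shows "traverse t seen = (Pointer (position t seen), seen)"
  using assms(3)
proof (induction t)
  case (Node l a r)
  then have "l \<in> set seen" "r \<in> set seen"
    using subtree_closed_node[OF assms(2)] by blast+
  then show ?case using Node by (simp add: visit_def)
qed (simp add: visit_def)

lemma fst_traverse_new:
  assumes "distinct seen" "subtree_closed (set seen)" "\<langle>l, a, r\<rangle> \<notin> set seen"
  shows "fst (traverse \<langle>l, a, r\<rangle> seen) =
    CNode (fst (traverse l seen)) (fst (traverse r (snd (traverse l seen))))"
proof -
  note 1 = snd_traverse[OF assms(1,2), of l]
  have "subtree_closed (set (snd (traverse l seen)))"
    using 1 subtree_closed_Un assms(2) by simp
  note 2 = snd_traverse[OF 1(1) this, of r]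
  have "\<langle>l, a, r\<rangle> \<notin> set (snd (traverse r (snd (traverse l seen))))"
    using 1 2 assms(3) by (simp add: node_notin_subtrees)
  then show ?thesis by (simp add: visit_def case_prod_beta Let_def)
qed

text \<open>A new tree is turned into \<open>CLeaf\<close> or \<open>CNode\<close>, so a
  \<open>Pointer\<close> can only come from a tree in \<open>seen\<close>, and its index recovers
  that tree.\<close>

lemma traverse_inj_seen:
  assumes "distinct seen" "subtree_closed (set seen)" "t \<in> set seen"
    and "fst (traverse t seen) = fst (traverse t' seen)"
  shows "t = t'"
proof -
  have p: "fst (traverse t' seen) = Pointer (position t seen)"
    using assms traverse_seen by simp
  have "t' \<in> set seen"
  proof (rule ccontr)
    assume "t' \<notin> set seen"
    then show False
      using p fst_traverse_new[OF assms(1,2)]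
      by (cases t') (simp_all add: visit_def del: traverse.simps(2))
  qed
  then have "position t' seen = position t seen"
    using p assms(1,2) traverse_seen by simp
  then show ?thesis using \<open>t' \<in> set seen\<close> assms(3) nth_position by metis
qed

text \<open>Left children are compared first. Once they agree, both right traversals start from the
  same list, so the induction hypothesis applies to the right children too.\<close>

lemma traverse_inj:
  assumes "distinct seen" "subtree_closed (set seen)"
    and "fst (traverse t seen) = fst (traverse t' seen)"
  shows "t = t'"
  using assms
proof (induction t arbitrary: t' seen)
  case Leaf
  show ?case
  proof (cases "\<langle>\<rangle> \<in> set seen \<or> t' \<in> set seen")
    case True
    then show ?thesis
      using traverse_inj_seen[OF Leaf(1,2) _ Leaf(3)] traverse_inj_seen[OF Leaf(1,2) _ Leaf(3)[symmetric]]
      by blast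
  next
    case False
    then show ?thesis using Leaf fst_traverse_new[OF Leaf(1,2)]
      by (cases t') (simp_all add: visit_def del: traverse.simps(2))
  qed
next
  case (Node l a r)
  note n = fst_traverse_new[OF Node.prems(1,2)]
  show ?case
  proof (cases "\<langle>l, a, r\<rangle> \<in> set seen \<or> t' \<in> set seen")
    case True
    then show ?thesis
      using traverse_inj_seen[OF Node.prems(1,2) _ Node.prems(3)]
        traverse_inj_seen[OF Node.prems(1,2) _ Node.prems(3)[symmetric]]
      by blast
  next
    case False
    then obtain l' a' r' where t'_eq: "t' = \<langle>l', a', r'\<rangle>"
      using n Node.prems(3) by (cases t') (auto simp: visit_def simp del: traverse.simps(2))
    have eq: "fst (traverse l seen) = fst (traverse l' seen)"
      "fst (traverse r (snd (traverse l seen))) = fst (traverse r' (snd (traverse l' seen)))"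
      using n[of l a r] n[of l' a' r'] False Node.prems(3) unfolding t'_eq by (simp_all del: traverse.simps)
    have l: "l = l'" by (rule Node.IH(1)[OF Node.prems(1,2) eq(1)])
    have "subtree_closed (set (snd (traverse l seen)))"
      using snd_traverse subtree_closed_Un Node.prems by simp
    then have "r = r'"
      using Node.IH(2)[OF snd_traverse(1)[OF Node.prems(1,2)], of l r'] eq(2) unfolding l by simp
    then show ?thesis using l t'_eq by simp
  qed
qed

lemma inj_compact: "inj Defs.compact"
proof (rule injI)
  fix t t' :: full_tree
  assume "Defs.compact t = Defs.compact t'"
  moreover have "subtree_closed (set [])" by (simp add: subtree_closed_def)
  ultimately show "t = t'"
    unfolding Defs.compact_def by (intro traverse_inj[of "[]"]) auto
qed

text \<open>The levels of the spine of the compacted form of \<open>t\<close>, when the trees in \<open>S\<close> have been seen.\<close>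

primrec new_levels :: "full_tree \<Rightarrow> full_tree set \<Rightarrow> nat set" where
  "new_levels \<langle>\<rangle> S = {}"
| "new_levels \<langle>l, a, r\<rangle> S = (if \<langle>l, a, r\<rangle> \<in> S then {}
     else {0} \<union> new_levels l S \<union> Suc ` new_levels r (S \<union> subtrees l))"

text \<open>The order of \<open>seen\<close> affects only the indices of pointers, never the spine,
  so the counting below can work with sets of seen trees.\<close>

lemma levels_traverse:
  assumes "distinct seen" "subtree_closed (set seen)"
  shows "levels (spine (fst (traverse t seen))) = new_levels t (set seen)"
  using assms
proof (induction t arbitrary: seen)
  case Leaf
  then show ?case by (simp add: visit_def)
next
  case (Node l a r)
  note sn = snd_traverse[OF Node.prems, of l]
  have cl: "subtree_closed (set (snd (traverse l seen)))"
    using sn subtree_closed_Un Node.prems by simp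
  show ?case
  proof (cases "\<langle>l, a, r\<rangle> \<in> set seen")
    case True
    then show ?thesis using traverse_seen[OF Node.prems True] by (simp del: traverse.simps)
  next
    case False
    show ?thesis
      unfolding fst_traverse_new[OF Node.prems False] spine.simps levels.simps
      using Node.IH(1)[OF Node.prems] Node.IH(2)[OF sn(1) cl] False sn(2)
      by (simp del: traverse.simps)
  qed
qed

definition new_trees :: "nat \<Rightarrow> full_tree set \<Rightarrow> nat \<Rightarrow> full_tree set" where
  "new_trees k S n = {t. t \<notin> S \<and> card (subtrees t - S) = n \<and> new_levels t S \<subseteq> {..k}}"

text \<open>The leaf is no spine node, so it may count as seen from the start.\<close>

lemma new_levels_insert_Leaf: "new_levels t (insert \<langle>\<rangle> S) = new_levels t S"
proof (induction t arbitrary: S)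
  case (Node l a r)
  show ?case by (simp add: Node.IH)
qed simp

lemma compacted_count_eq:
  assumes "n > 0"
  shows "compacted_count k n = card (new_trees k {\<langle>\<rangle>} n)"
proof -
  have "right_height (spine (Defs.compact t)) \<le> k \<longleftrightarrow> new_levels t {\<langle>\<rangle>} \<subseteq> {..k}" for t
  proof -
    have "right_height (spine (Defs.compact t)) \<le> k \<longleftrightarrow> levels (spine (Defs.compact t)) \<subseteq> {..k}"
      unfolding right_height_def by (subst Max_le_iff) (auto simp: finite_levels)
    also have "levels (spine (Defs.compact t)) = new_levels t {\<langle>\<rangle>}"
      using levels_traverse[of "[]"] new_levels_insert_Leaf[of t "{}"]
      by (simp add: Defs.compact_def subtree_closed_def)
    finally show ?thesis .
  qed
  \<comment> \<open>\<open>n > 0\<close> excludes the single leaf, which has size 0 but is not new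
    relative to a set containing it.\<close>
  then have "bounded_compacted k n = Defs.compact ` new_trees k {\<langle>\<rangle>} n"
    unfolding bounded_compacted_def new_trees_def using assms by (auto simp: csize_compact intro!: imageI)
  then show ?thesis
    unfolding compacted_count_def using inj_compact by (metis card_image inj_on_subset subset_UNIV)
qed

section \<open>Recurrence by levels\<close>

text \<open>
  Read a compacted tree in post-order and record the level of the node just completed.  If \<open>p\<close>
  internal nodes are known, then one more node is completed on the same level in \<open>p + 1\<close> ways (its
  right child is a pointer), on the previous level in one way (its right subtree is finished), and
  \<open>d > 0\<close> levels further in \<open>(p + 1) ^ (d - 1) * (p\<^sup>2 + p + 1)\<close> ways: \<open>d - 1\<close> left pointers followed by a
  node with two pointers, where \<open>p\<close> of the \<open>(p + 1)\<^sup>2\<close> pairs of pointers would repeat a known node.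
  \<open>chain_weight k m n j\<close> counts the ways to complete \<open>n + 1\<close> nodes, the last one on level \<open>j\<close>, when
  \<open>m\<close> internal nodes were known at the start and no level exceeds \<open>k\<close>.
\<close>

definition chain_step :: "nat \<Rightarrow> (nat \<Rightarrow> nat) \<Rightarrow> nat \<Rightarrow> nat" where
  "chain_step p f j =
    (p + 1) * f j + f (Suc j) + (\<Sum>i<j. (p + 1) ^ (j - i - 1) * (p\<^sup>2 + p + 1) * f i)"

primrec chain_weight :: "nat \<Rightarrow> nat \<Rightarrow> nat \<Rightarrow> nat \<Rightarrow> nat" where
  "chain_weight k m 0 j = (if j \<le> k then (m + 1) ^ j * (m\<^sup>2 + m + 1) else 0)"
| "chain_weight k m (Suc n) j = (if j \<le> k then chain_step (m + n + 1) (chain_weight k m n) j else 0)"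

lemma chain_weight_gt: "j > k \<Longrightarrow> chain_weight k m n j = 0"
  by (cases n) auto

lemma chain_step_add: "chain_step p (\<lambda>j. f j + g j) j = chain_step p f j + chain_step p g j"
  by (simp add: chain_step_def algebra_simps sum.distrib)

lemma chain_step_mult: "chain_step p (\<lambda>j. c * f j) j = c * chain_step p f j"
  by (simp add: chain_step_def algebra_simps sum_distrib_left)

lemma chain_step_sum: "chain_step p (\<lambda>j. \<Sum>a<(n::nat). f a j) j = (\<Sum>a<n. chain_step p (f a) j)"
proof (induction n)
  case 0
  then show ?case by (simp add: chain_step_def)
next
  case (Suc n)
  then show ?case by (simp add: chain_step_add)
qed

text \<open>The coefficient of \<open>f 0\<close> is the initial weight
  \<open>chain_weight k p 0 j\<close> for \<open>j \<le> k\<close>: leaving level 0 starts a fresh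
  chain one level up, with \<open>p\<close> nodes known.\<close>

lemma chain_step_Suc:
  "chain_step p f (Suc j) = chain_step p (\<lambda>j. f (Suc j)) j + (p + 1) ^ j * (p\<^sup>2 + p + 1) * f 0"
  by (simp add: chain_step_def sum.lessThan_Suc_shift del: sum.lessThan_Suc)

text \<open>The idea is to cut the sequence of levels at the last visit to level 0.\<close>

lemma chain_weight_decompose:
  "chain_weight (Suc k) m n (Suc j) = (m + 1) * chain_weight k m n j +
    (\<Sum>a<n. chain_weight (Suc k) m a 0 * chain_weight k (m + a + 1) (n - 1 - a) j)"
proof (cases "j \<le> k")
  case False
  then show ?thesis by (simp add: chain_weight_gt)
next
  case True
  then show ?thesis
  proof (induction n arbitrary: j)
    case 0
    \<comment> \<open>A start on level \<open>Suc j\<close> has one factor \<open>m + 1\<close> more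
      than a start on level \<open>j\<close>, for a left pointer at level 0. The factor stays with
      the chains that never visit level 0.\<close>
    then show ?case by (simp add: algebra_simps)
  next
    case (Suc n)
    let ?p = "m + n + 1"
    let ?f = "\<lambda>j. (m + 1) * chain_weight k m n j +
      (\<Sum>a<n. chain_weight (Suc k) m a 0 * chain_weight k (m + a + 1) (n - 1 - a) j)"
    have eq: "chain_weight (Suc k) m n (Suc i) = ?f i" for i
      using Suc.IH[of i] by (cases "i \<le> k") (simp_all add: chain_weight_gt)
    have tail: "chain_step ?p (chain_weight k (m + a + 1) (n - 1 - a)) j
        = chain_weight k (m + a + 1) (n - a) j" if "a < n" for a
    proof -
      obtain b where b: "n = a + Suc b" using \<open>a < n\<close> less_iff_Suc_add by auto
      then show ?thesis using Suc.prems by (simp add: add_ac)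
    qed
    have "chain_weight (Suc k) m (Suc n) (Suc j) = chain_step ?p ?f j
        + (?p + 1) ^ j * (?p\<^sup>2 + ?p + 1) * chain_weight (Suc k) m n 0"
      using Suc.prems by (simp only: chain_weight.simps chain_step_Suc eq Suc_le_mono if_True)
    \<comment> \<open>Chains on level 0 at index \<open>n\<close> give the new summand
      \<open>a = n\<close>; all others are extended by \<open>tail\<close>.\<close>
    also have "(?p + 1) ^ j * (?p\<^sup>2 + ?p + 1) = chain_weight k (m + n + 1) 0 j"
      using Suc.prems by simp
    also have "chain_step ?p ?f j = (m + 1) * chain_weight k m (Suc n) j
        + (\<Sum>a<n. chain_weight (Suc k) m a 0 * chain_weight k (m + a + 1) (n - a) j)"
      unfolding chain_step_add chain_step_sum chain_step_mult
      using Suc.prems tail by simp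
    finally show ?case by (simp add: mult.commute)
  qed
qed

text \<open>The levels of a right subtree count one more when seen from the parent. The shift by
  \<open>Suc\<close> treats all bounds alike, including bound 0, where no right subtree is possible
  once the leaf is seen.\<close>

definition new_right_trees :: "nat \<Rightarrow> full_tree set \<Rightarrow> nat \<Rightarrow> full_tree set" where
  "new_right_trees k S n = {t. t \<notin> S \<and> card (subtrees t - S) = n \<and> Suc ` new_levels t S \<subseteq> {..k}}"

lemma new_right_trees_0: "\<langle>\<rangle> \<in> S \<Longrightarrow> new_right_trees 0 S n = {}"
proof -
  assume "\<langle>\<rangle> \<in> S"
  then have "new_levels t S \<noteq> {}" if "t \<notin> S" for t
    using that by (cases t) auto
  then show ?thesis unfolding new_right_trees_def by auto
qed

lemma new_right_trees_Suc: "new_right_trees (Suc k) S n = new_trees k S n"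
  unfolding new_right_trees_def new_trees_def by auto

lemma card_new_subtrees_node:
  assumes "subtree_closed S" "\<langle>l, a, r\<rangle> \<notin> S"
  shows "card (subtrees \<langle>l, a, r\<rangle> - S) =
    Suc (card (subtrees l - S) + card (subtrees r - (S \<union> subtrees l)))"
proof -
  have "subtrees \<langle>l, a, r\<rangle> - S =
      insert \<langle>l, a, r\<rangle> ((subtrees l - S) \<union> (subtrees r - (S \<union> subtrees l)))"
    using assms(2) by auto
  moreover have "\<langle>l, a, r\<rangle> \<notin> (subtrees l - S) \<union> (subtrees r - (S \<union> subtrees l))"
    by (simp add: node_notin_subtrees)
  moreover have "card ((subtrees l - S) \<union> (subtrees r - (S \<union> subtrees l))) =
      card (subtrees l - S) + card (subtrees r - (S \<union> subtrees l))"
    by (intro card_Un_disjoint) (auto simp: finite_subtrees)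
  ultimately show ?thesis by (simp add: finite_subtrees)
qed

lemma card_new_subtrees_seen: "subtree_closed S \<Longrightarrow> t \<in> S \<Longrightarrow> card (subtrees t - S) = 0"
  by (simp add: subtree_closed_def Diff_eq_empty_iff[THEN iffD2])

lemma card_new_subtrees_new: "t \<notin> S \<Longrightarrow> card (subtrees t - S) > 0"
  using self_in_subtrees[of t] by (auto simp: card_gt_0_iff finite_subtrees)

lemma new_levels_seen: "t \<in> S \<Longrightarrow> new_levels t S = {}"
  by (cases t) auto

lemma card_Un_subtrees:
  assumes "finite S"
  shows "card (S \<union> subtrees t) = card S + card (subtrees t - S)"
proof -
  have "card (S \<union> (subtrees t - S)) = card S + card (subtrees t - S)"
    using assms by (intro card_Un_disjoint) (auto simp: finite_subtrees)
  then show ?thesis by simp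
qed

text \<open>The cases are: both children seen, only the right one, only the left one, none; the
  right child is judged after the left subtree has been visited. By closure a node in
  \<open>S\<close> has both children in \<open>S\<close>, so only the first case must exclude
  it.\<close>

lemma node_in_new_trees_iff:
  assumes S: "subtree_closed S"
  shows "\<langle>l, a, r\<rangle> \<in> new_trees k S (Suc n) \<longleftrightarrow>
    (n = 0 \<and> l \<in> S \<and> r \<in> S \<and> \<langle>l, a, r\<rangle> \<notin> S) \<or>
    (l \<in> new_trees k S n \<and> r \<in> S \<union> subtrees l) \<or>
    (l \<in> S \<and> r \<in> new_right_trees k S n) \<or>
    (\<exists>i\<in>{1..<n}. l \<in> new_trees k S i \<and> r \<in> new_right_trees k (S \<union> subtrees l) (n - i))"
proof -
  let ?S' = "S \<union> subtrees l"
  let ?x = "card (subtrees l - S)" and ?y = "card (subtrees r - ?S')"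
  have S': "subtree_closed ?S'" using S by (rule subtree_closed_Un)
  have T: "t \<in> new_trees k S i \<longleftrightarrow> t \<notin> S \<and> card (subtrees t - S) = i \<and> new_levels t S \<subseteq> {..k}"
    for t S i unfolding new_trees_def by simp
  have R: "t \<in> new_right_trees k S i \<longleftrightarrow>
      t \<notin> S \<and> card (subtrees t - S) = i \<and> Suc ` new_levels t S \<subseteq> {..k}"
    for t S i unfolding new_right_trees_def by simp
  have ex: "(\<exists>i\<in>{1..<n}. l \<in> new_trees k S i \<and> r \<in> new_right_trees k ?S' (n - i)) \<longleftrightarrow>
      ?x \<in> {1..<n} \<and> l \<in> new_trees k S ?x \<and> r \<in> new_right_trees k ?S' (n - ?x)"
    unfolding T by blast
  show ?thesis
  proof (cases "\<langle>l, a, r\<rangle> \<in> S")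
    case True
    then have "l \<in> S" "r \<in> S" using subtree_closed_node[OF S] by blast+
    then show ?thesis using True unfolding ex unfolding T R by blast
  next
    case False
    have iff: "\<langle>l, a, r\<rangle> \<in> new_trees k S (Suc n) \<longleftrightarrow>
        ?x + ?y = n \<and> new_levels l S \<subseteq> {..k} \<and> Suc ` new_levels r ?S' \<subseteq> {..k}"
      unfolding T using False card_new_subtrees_node[OF S False] by simp
    show ?thesis
    proof (cases "l \<in> S")
      case True
      then have SS: "?S' = S" and x: "?x = 0" and ll: "new_levels l S = {}"
        using S card_new_subtrees_seen new_levels_seen by (auto simp: subtree_closed_def)
      show ?thesis
      proof (cases "r \<in> S")
        case r: True
        then have "card (subtrees r - S) = 0" "new_levels r S = {}"
          using card_new_subtrees_seen[OF S] new_levels_seen by blast+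
        then show ?thesis unfolding iff ex unfolding T R SS x ll using True r False by auto
      next
        case r: False
        then show ?thesis unfolding iff ex unfolding T R SS x ll using True by auto
      qed
    next
      case l: False
      then have x: "?x > 0" by (rule card_new_subtrees_new)
      show ?thesis
      proof (cases "r \<in> ?S'")
        case True
        then have "?y = 0" "new_levels r ?S' = {}"
          using card_new_subtrees_seen[OF S'] new_levels_seen by blast+
        then show ?thesis unfolding iff ex unfolding T R using l True by auto
      next
        case r: False
        then have "?y > 0" by (rule card_new_subtrees_new)
        then have "?x + ?y = n \<longleftrightarrow> ?x \<in> {1..<n} \<and> ?y = n - ?x" using x by auto
        then show ?thesis unfolding iff ex unfolding T R using l r by blast
      qed
    qed
  qed
qed

lemma new_trees_eq_image:
  assumes "subtree_closed S" "\<langle>\<rangle> \<in> S"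
  shows "new_trees k S (Suc n) = (\<lambda>(l, r). \<langle>l, (), r\<rangle>) `
    ({(l, r). n = 0 \<and> l \<in> S \<and> r \<in> S \<and> \<langle>l, (), r\<rangle> \<notin> S} \<union>
     Sigma (new_trees k S n) (\<lambda>l. S \<union> subtrees l) \<union>
     S \<times> new_right_trees k S n \<union>
     (\<Union>i\<in>{1..<n}. Sigma (new_trees k S i) (\<lambda>l. new_right_trees k (S \<union> subtrees l) (n - i))))"
    (is "_ = ?f ` ?X")
proof -
  have iff: "\<langle>l, (), r\<rangle> \<in> new_trees k S (Suc n) \<longleftrightarrow> (l, r) \<in> ?X" for l r
    unfolding node_in_new_trees_iff[OF assms(1)] by blast
  show ?thesis
  proof (rule set_eqI)
    fix t
    show "t \<in> new_trees k S (Suc n) \<longleftrightarrow> t \<in> ?f ` ?X"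
    proof (cases t)
      case Leaf
      then show ?thesis using assms(2) unfolding new_trees_def by auto
    next
      case (Node l a r)
      have "t \<in> ?f ` ?X \<longleftrightarrow> (l, r) \<in> ?X" using Node by (auto simp only: image_iff split_beta) force+
      then show ?thesis using iff[of l r] Node by simp
    qed
  qed
qed

lemma new_trees_0: "new_trees k S 0 = {}"
  unfolding new_trees_def using card_new_subtrees_new by fastforce

lemma new_right_trees_size_0: "new_right_trees k S 0 = {}"
  unfolding new_right_trees_def using card_new_subtrees_new by fastforce

text \<open>Of the \<open>(m + 1)\<^sup>2\<close> pairs of seen trees, exactly \<open>m\<close> are
  the children of an internal tree in \<open>S\<close>, by closure.\<close>

lemma card_new_cherries:
  assumes "subtree_closed S" "\<langle>\<rangle> \<in> S" "finite S" "card S = Suc m"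
  shows "card {(l, r). l \<in> S \<and> r \<in> S \<and> \<langle>l, (), r\<rangle> \<notin> S} = m\<^sup>2 + m + 1"
proof -
  let ?f = "\<lambda>(l, r). \<langle>l, (), r\<rangle>"
  let ?Z = "{(l, r). l \<in> S \<and> r \<in> S \<and> \<langle>l, (), r\<rangle> \<notin> S}"
  let ?Y = "{(l, r). \<langle>l, (), r\<rangle> \<in> S}"
  have Y: "?Y \<subseteq> S \<times> S" using subtree_closed_node[OF assms(1)] by blast
  have "?f ` ?Y = S - {\<langle>\<rangle>}"
  proof (rule set_eqI)
    fix t :: full_tree
    show "t \<in> ?f ` ?Y \<longleftrightarrow> t \<in> S - {\<langle>\<rangle>}"
      by (cases t) (auto simp: image_iff)
  qed
  moreover have "inj_on ?f ?Y" by (auto simp: inj_on_def)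
  ultimately have "card ?Y = card (S - {\<langle>\<rangle>})" by (metis card_image)
  then have "card ?Y = m" using assms by simp
  moreover have "card (S \<times> S) = (m + 1) * (m + 1)" using assms by (simp add: card_cartesian_product)
  moreover have "?Z = S \<times> S - ?Y" by auto
  moreover have "card (S \<times> S - ?Y) = card (S \<times> S) - card ?Y"
    using Y assms(3) by (meson card_Diff_subset finite_SigmaI finite_subset)
  ultimately show ?thesis by (simp add: power2_eq_square)
qed

text \<open>The number depends on \<open>S\<close> only through its cardinality, so the counts for
  the two children multiply. The cases at the root add up to \<open>chain_step\<close> at level 0,
  with the entry at level 1 expanded by \<open>chain_weight_decompose\<close>.\<close>

lemma card_new_trees:
  assumes "subtree_closed S" "\<langle>\<rangle> \<in> S" "finite S" "card S = Suc m"
  shows "finite (new_trees k S (Suc n)) \<and> card (new_trees k S (Suc n)) = chain_weight k m n 0"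
  using assms
proof (induction n arbitrary: k S m rule: less_induct)
  case (less n)
  let ?f = "\<lambda>(l, r). \<langle>l, (), r :: full_tree\<rangle>"
  have inj: "inj_on ?f X" for X by (auto simp: inj_on_def)
  note img = new_trees_eq_image[OF less.prems(1,2)]
  show ?case
  proof (cases n)
    case 0
    let ?Z = "{(l, r). l \<in> S \<and> r \<in> S \<and> \<langle>l, (), r\<rangle> \<notin> S}"
    have eq: "new_trees k S (Suc n) = ?f ` ?Z"
      unfolding img 0 by (simp add: new_trees_0 new_right_trees_size_0)
    have "finite (S \<times> S)" using less.prems(3) by simp
    then have "finite ?Z" by (rule rev_finite_subset) auto
    then show ?thesis
      unfolding eq card_image[OF inj] card_new_cherries[OF less.prems] by (simp add: 0)
  next
    case (Suc n')
    let ?A = "Sigma (new_trees k S n) (\<lambda>l. S \<union> subtrees l)"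
    let ?B = "S \<times> new_right_trees k S n"
    let ?C = "\<lambda>a. Sigma (new_trees k S (Suc a)) (\<lambda>l. new_right_trees k (S \<union> subtrees l) (n' - a))"
    \<comment> \<open>\<open>w\<close> counts right subtrees with \<open>n + 1\<close> new nodes;
      with bound 0 there are none.\<close>
    define w where "w m n = (case k of 0 \<Rightarrow> 0 | Suc k' \<Rightarrow> chain_weight k' m n 0)" for m n
    have right: "finite (new_right_trees k S' (Suc b)) \<and> card (new_right_trees k S' (Suc b)) = w m' b"
      if "b < n" "subtree_closed S'" "\<langle>\<rangle> \<in> S'" "finite S'" "card S' = Suc m'" for b S' m'
      using less.IH[OF that] that(3)
      by (cases k) (simp_all add: w_def new_right_trees_0 new_right_trees_Suc)
    have ext: "subtree_closed (S \<union> subtrees l) \<and> \<langle>\<rangle> \<in> S \<union> subtrees l \<and> finite (S \<union> subtrees l) \<and>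
        card (S \<union> subtrees l) = Suc (m + i)" if "l \<in> new_trees k S i" for l i
      using that less.prems subtree_closed_Un card_Un_subtrees[of S l]
      by (simp add: new_trees_def finite_subtrees)
    have A: "finite ?A" "card ?A = chain_weight k m n' 0 * (m + n + 1)"
    proof -
      have IH: "finite (new_trees k S n)" "card (new_trees k S n) = chain_weight k m n' 0"
        using less.IH[of n', OF _ less.prems] Suc by auto
      show "finite ?A" using IH ext by (intro finite_SigmaI) auto
      have "card ?A = (\<Sum>l\<in>new_trees k S n. card (S \<union> subtrees l))"
        using IH ext by (intro card_SigmaI) auto
      also have "\<dots> = (\<Sum>l\<in>new_trees k S n. m + n + 1)"
        using ext by (intro sum.cong) auto
      finally show "card ?A = chain_weight k m n' 0 * (m + n + 1)" using IH by simp
    qed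
    have B: "finite ?B" "card ?B = (m + 1) * w m n'"
      using right[of n' S m] less.prems Suc by (simp_all add: card_cartesian_product)
    have C: "finite (?C a) \<and> card (?C a) = chain_weight k m a 0 * w (m + a + 1) (n' - 1 - a)"
      if "a < n'" for a
    proof -
      have IH: "finite (new_trees k S (Suc a))" "card (new_trees k S (Suc a)) = chain_weight k m a 0"
        using less.IH[of a, OF _ less.prems] that Suc by auto
      have "n' - a = Suc (n' - 1 - a)" using that by simp
      then have r: "finite (new_right_trees k (S \<union> subtrees l) (n' - a)) \<and>
          card (new_right_trees k (S \<union> subtrees l) (n' - a)) = w (m + a + 1) (n' - 1 - a)"
        if "l \<in> new_trees k S (Suc a)" for l
        using right[of "n' - 1 - a" "S \<union> subtrees l" "m + a + 1"] ext[OF that] Suc by simp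
      have "card (?C a) = (\<Sum>l\<in>new_trees k S (Suc a). card (new_right_trees k (S \<union> subtrees l) (n' - a)))"
        using IH r by (intro card_SigmaI) auto
      also have "\<dots> = (\<Sum>l\<in>new_trees k S (Suc a). w (m + a + 1) (n' - 1 - a))"
        using r by (intro sum.cong) auto
      finally show ?thesis using IH r by auto
    qed
    have shift: "(\<Union>i\<in>{1..<n}. Sigma (new_trees k S i) (\<lambda>l. new_right_trees k (S \<union> subtrees l) (n - i))) =
        (\<Union>a\<in>{..<n'}. ?C a)"
    proof -
      have "{1..<n} = Suc ` {..<n'}"
        unfolding Suc by (simp add: lessThan_atLeast0)
      then show ?thesis unfolding Suc by simp
    qed
    have eq: "new_trees k S (Suc n) = ?f ` (?A \<union> ?B \<union> (\<Union>a\<in>{..<n'}. ?C a))"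
      unfolding img shift using Suc by simp
    have new: "l \<notin> S" if "l \<in> new_trees k S i" for l i
      using that by (simp add: new_trees_def)
    have rnew: "r \<notin> S \<union> subtrees l" if "r \<in> new_right_trees k (S \<union> subtrees l) i" for r l i
      using that by (simp add: new_right_trees_def)
    have size: "i = j" if "l \<in> new_trees k S i" "l \<in> new_trees k S j" for l i j
      using that by (simp add: new_trees_def)
    have "card (\<Union>a\<in>{..<n'}. ?C a) = (\<Sum>a<n'. card (?C a))"
      using C size by (intro card_UN_disjoint) fastforce+
    then have C': "card (\<Union>a\<in>{..<n'}. ?C a) =
        (\<Sum>a<n'. chain_weight k m a 0 * w (m + a + 1) (n' - 1 - a))"
      using C by simp
    have finC: "finite (\<Union>a\<in>{..<n'}. ?C a)" using C by blast
    have dis: "?A \<inter> ?B = {}" "(?A \<union> ?B) \<inter> (\<Union>a\<in>{..<n'}. ?C a) = {}"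
      using new rnew by blast+
    have "card (?A \<union> ?B \<union> (\<Union>a\<in>{..<n'}. ?C a)) =
        card ?A + card ?B + card (\<Union>a\<in>{..<n'}. ?C a)"
      using A(1) B(1) finC dis by (simp add: card_Un_disjoint)
    \<comment> \<open>\<open>?A\<close> is the term for staying on level 0; \<open>?B\<close> and
      the \<open>?C a\<close> add up to the entry at level 1, which vanishes for
      \<open>k = 0\<close>.\<close>
    also have "\<dots> = chain_weight k m n 0"
    proof (cases k)
      case 0
      then show ?thesis
        unfolding A B C' by (simp add: \<open>n = Suc n'\<close> w_def chain_step_def chain_weight_gt)
    next
      case (Suc k')
      then show ?thesis
        unfolding A B C' using chain_weight_decompose[of k' m n' 0]
        by (simp add: \<open>n = Suc n'\<close> w_def chain_step_def)
    qed
    finally show ?thesis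
      unfolding eq card_image[OF inj] using A(1) B(1) finC by blast
  qed
qed

lemma compacted_count_eq_chain_weight: "compacted_count k (Suc n) = chain_weight k 0 n 0"
  using compacted_count_eq[of "Suc n" k] card_new_trees[of "{\<langle>\<rangle>}" 0 k n]
  by (simp add: subtree_closed_def)

section \<open>Products of nearly stochastic matrices\<close>

text \<open>Up to factors controlled by the partial sums of \<open>\<epsilon>\<close>, the minimum
  of \<open>r m\<close> increases and the maximum decreases, so both converge. Within
  \<open>k + 1\<close> steps the maximum raises the minimum by a fixed fraction of their distance,
  so the limits coincide.\<close>

lemma perturbed_stochastic_convergence:
  fixes P :: "nat \<Rightarrow> nat \<Rightarrow> nat \<Rightarrow> real" and r :: "nat \<Rightarrow> nat \<Rightarrow> real" and \<epsilon> :: "nat \<Rightarrow> real"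
  assumes rec: "\<And>m j. j \<le> k \<Longrightarrow> r (Suc m) j = (\<Sum>i\<le>k. P m j i * r m i)"
    and pos: "\<And>j. j \<le> k \<Longrightarrow> r 0 j > 0"
    and nonneg: "\<And>m j i. j \<le> k \<Longrightarrow> i \<le> k \<Longrightarrow> P m j i \<ge> 0"
    and lower: "\<And>m j i. j \<le> k \<Longrightarrow> i \<le> k \<Longrightarrow> i \<le> Suc j \<Longrightarrow> P m j i \<ge> \<delta>"
    and delta: "\<delta> > 0"
    and row: "\<And>m j. j \<le> k \<Longrightarrow> \<bar>(\<Sum>i\<le>k. P m j i) - 1\<bar> \<le> \<epsilon> m"
    and eps: "\<And>m. \<epsilon> m \<le> 1 / 2" "summable \<epsilon>"
  shows "\<exists>c>0. \<forall>j\<le>k. (\<lambda>m. r m j) \<longlonglongrightarrow> c"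
proof -
  define S where "S m = (\<Sum>i<m. \<epsilon> i)" for m
  define mx where "mx m = Max (r m ` {..k})" for m
  define mn where "mn m = Min (r m ` {..k})" for m
  have eps0: "\<epsilon> m \<ge> 0" for m using row[of 0 m] by linarith
  have mx_ge: "r m j \<le> mx m" if "j \<le> k" for m j
    unfolding mx_def using that by (intro Max_ge) auto
  have mn_le: "mn m \<le> r m j" if "j \<le> k" for m j
    unfolding mn_def using that by (intro Min_le) auto
  have mx_at: "\<exists>j\<le>k. mx m = r m j" for m
  proof -
    have "mx m \<in> r m ` {..k}" unfolding mx_def by (intro Max_in) auto
    then show ?thesis by auto
  qed
  have mn_at: "\<exists>j\<le>k. mn m = r m j" for m
  proof -
    have "mn m \<in> r m ` {..k}" unfolding mn_def by (intro Min_in) auto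
    then show ?thesis by auto
  qed
  \<comment> \<open>Here the bound 1/2 on \<open>\<epsilon>\<close> enters: a row sum of at least
    \<open>1 - e\<close> costs at most the factor \<open>exp (- 2 * e)\<close>, and such factors
    combine into partial sums.\<close>
  have exp_low: "exp (- 2 * e) \<le> 1 - e" if "0 \<le> e" "e \<le> 1 / 2" for e :: real
  proof -
    have "1 \<le> (1 - e) * (1 + 2 * e)"
      using that mult_left_mono[of e "1/2" e] by (simp add: algebra_simps)
    also have "\<dots> \<le> (1 - e) * exp (2 * e)"
      using that exp_ge_add_one_self[of "2 * e"] by (intro mult_left_mono) auto
    finally show ?thesis by (simp add: exp_minus field_simps)
  qed
  let ?E = "\<lambda>m s. exp (- 2 * (S (m + s) - S m))"
  \<comment> \<open>\<open>z\<close> is the excess of entry \<open>i1\<close> over the common lower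
    bound \<open>b\<close>. Up to the factors \<open>?E\<close>, a fraction \<open>\<delta>\<close>
    of it reaches every row \<open>j\<close> with \<open>i1 \<le> Suc j\<close>.\<close>
  have step: "?E m (Suc s) * b + ?E m (Suc s) * (\<delta> * z) \<le> r (m + Suc s) j"
    if all: "\<And>i. i \<le> k \<Longrightarrow> ?E m s * b \<le> r (m + s) i" and spec: "?E m s * (b + z) \<le> r (m + s) i1"
      and i1: "i1 \<le> k" "i1 \<le> Suc j" and j: "j \<le> k" and b: "0 \<le> b" and z: "0 \<le> z"
    for m s j i1 b z
  proof -
    have E: "?E m (Suc s) = exp (- 2 * \<epsilon> (m + s)) * ?E m s"
      by (simp add: S_def flip: exp_add)
    have low: "exp (- 2 * \<epsilon> (m + s)) \<le> 1 - \<epsilon> (m + s)" using exp_low eps0 eps(1) by blast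
    have sums: "exp (- 2 * \<epsilon> (m + s)) \<le> (\<Sum>i\<le>k. P (m + s) j i)"
      using row[OF j, of "m + s"] low by linarith
    have "exp (- 2 * \<epsilon> (m + s)) * (\<delta> * z) \<le> 1 * (\<delta> * z)"
      using eps0 delta z by (intro mult_right_mono) auto
    also have "\<dots> \<le> P (m + s) j i1 * z" using lower[OF j i1] z by (simp add: mult_right_mono)
    finally have main: "exp (- 2 * \<epsilon> (m + s)) * (\<delta> * z) \<le> P (m + s) j i1 * z" .
    have "?E m (Suc s) * b + ?E m (Suc s) * (\<delta> * z)
        = ?E m s * (exp (- 2 * \<epsilon> (m + s)) * b) + ?E m s * (exp (- 2 * \<epsilon> (m + s)) * (\<delta> * z))"
      unfolding E by simp
    also have "\<dots> \<le> ?E m s * ((\<Sum>i\<le>k. P (m + s) j i) * b) + ?E m s * (P (m + s) j i1 * z)"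
      by (rule add_mono; rule mult_left_mono) (use b main sums in \<open>auto intro: mult_right_mono\<close>)
    also have "\<dots> = (\<Sum>i\<le>k. P (m + s) j i * (?E m s * (b + (if i = i1 then z else 0))))"
    proof -
      have "(\<Sum>i\<le>k. P (m + s) j i * (?E m s * (b + (if i = i1 then z else 0))))
          = (\<Sum>i\<le>k. ?E m s * (P (m + s) j i * b)
              + (if i = i1 then ?E m s * (P (m + s) j i1 * z) else 0))"
        by (intro sum.cong) (auto simp: algebra_simps)
      then show ?thesis using i1
        by (simp add: sum.distrib sum_distrib_left sum_distrib_right)
    qed
    also have "\<dots> \<le> (\<Sum>i\<le>k. P (m + s) j i * r (m + s) i)"
      using all spec nonneg[OF j] by (intro sum_mono mult_left_mono) auto
    also have "\<dots> = r (m + Suc s) j" using rec[OF j] by simp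
    finally show ?thesis .
  qed
  have pos': "r m j > 0" if "j \<le> k" for m j
    using that
  proof (induction m arbitrary: j)
    case 0
    then show ?case using pos by simp
  next
    case (Suc m)
    have "0 < \<delta> * r m j" using Suc delta by simp
    also have "\<dots> \<le> P m j j * r m j" using lower[of j j m] Suc by (simp add: less_imp_le)
    also have "\<dots> \<le> (\<Sum>i\<le>k. P m j i * r m i)"
      using Suc nonneg less_imp_le[OF Suc.IH] by (intro member_le_sum) auto
    finally show ?case using rec Suc.prems by simp
  qed
  have mn_pos: "mn m > 0" for m using mn_at[of m] pos' by force
  have base: "?E m s * mn m \<le> r (m + s) j" if "j \<le> k" for m s j
    using that
  proof (induction s arbitrary: j)
    case 0
    then show ?case using mn_le by simp
  next
    case (Suc s)
    then show ?case using step[where m = m and s = s and b = "mn m" and z = 0 and j = j and ?i1.0 = j]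
        mn_pos[of m] by simp
  qed
  \<comment> \<open>An entry above the minimum influences every position within \<open>k + 1\<close> steps.\<close>
  have window: "r (m + Suc s) j \<ge> ?E m (Suc s) * (mn m + \<delta> ^ Suc s * (r m i - mn m))"
    if "i \<le> k" "j \<le> k" "i \<le> j + Suc s" for m s j i
    using that(2,3)
  proof (induction s arbitrary: j)
    case 0
    then show ?case
      using step[where m = m and s = 0 and b = "mn m" and z = "r m i - mn m" and j = j and ?i1.0 = i]
        \<open>i \<le> k\<close> mn_pos[of m] mn_le by (simp add: distrib_left)
  next
    case (Suc s)
    \<comment> \<open>The excess is passed on from index \<open>Suc j\<close>, or from
      \<open>k\<close> itself when \<open>j = k\<close>.\<close>
    show ?case
      using step[where m = m and s = "Suc s" and b = "mn m" and z = "\<delta> ^ Suc s * (r m i - mn m)"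
          and j = j and ?i1.0 = "min k (Suc j)", OF base Suc.IH]
        Suc.prems \<open>i \<le> k\<close> mn_pos[of m] mn_le[of i m] delta
      by (simp add: distrib_left mult.assoc min_def split: if_splits)
  qed
  have mx_step: "mx (Suc m) \<le> exp (\<epsilon> m) * mx m" for m
  proof -
    obtain j where j: "j \<le> k" "mx (Suc m) = r (Suc m) j" using mx_at by blast
    have "mx (Suc m) = (\<Sum>i\<le>k. P m j i * r m i)" using j rec by simp
    also have "\<dots> \<le> (\<Sum>i\<le>k. P m j i * mx m)"
      using mx_ge nonneg j by (intro sum_mono mult_left_mono) auto
    also have "\<dots> = (\<Sum>i\<le>k. P m j i) * mx m" by (simp add: sum_distrib_right)
    also have "\<dots> \<le> exp (\<epsilon> m) * mx m"
    proof (rule mult_right_mono)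
      show "(\<Sum>i\<le>k. P m j i) \<le> exp (\<epsilon> m)"
        using row[OF j(1), of m] exp_ge_add_one_self[of "\<epsilon> m"] by linarith
      show "0 \<le> mx m" using mx_ge[of 0 m] pos'[of 0 m] by linarith
    qed
    finally show ?thesis .
  qed
  define s where "s = suminf \<epsilon>"
  have S_lim: "S \<longlonglongrightarrow> s"
    unfolding S_def s_def using eps(2) by (rule summable_LIMSEQ)
  have S_le: "S m \<le> s" for m
    unfolding S_def s_def using eps0 eps(2) by (intro sum_le_suminf) auto
  have dec: "decseq (\<lambda>m. mx m * exp (- S m))"
  proof (rule decseq_SucI)
    fix m
    have "mx (Suc m) * exp (- S (Suc m)) \<le> exp (\<epsilon> m) * mx m * exp (- S (Suc m))"
      using mx_step by (intro mult_right_mono) auto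
    also have "\<dots> = mx m * (exp (\<epsilon> m) * exp (- S (Suc m)))" by simp
    also have "exp (\<epsilon> m) * exp (- S (Suc m)) = exp (- S m)"
      by (simp add: S_def flip: exp_add)
    finally show "mx (Suc m) * exp (- S (Suc m)) \<le> mx m * exp (- S m)" .
  qed
  have mx_pos: "mx m > 0" for m using mx_ge[of 0 m] pos'[of 0 m] by linarith
  obtain U' where U': "(\<lambda>m. mx m * exp (- S m)) \<longlonglongrightarrow> U'"
    using decseq_convergent[OF dec, of 0] mx_pos by (metis less_imp_le mult_pos_pos exp_gt_zero)
  have inc: "incseq (\<lambda>m. mn m * exp (2 * S m))"
  proof (rule incseq_SucI)
    fix m
    obtain j where j: "j \<le> k" "mn (Suc m) = r (Suc m) j" using mn_at by blast
    have le: "?E m 1 * mn m \<le> mn (Suc m)" using base[OF j(1), of m 1] j by simp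
    have "mn m * exp (2 * S m) = mn m * (?E m 1 * exp (2 * S (Suc m)))"
      by (simp flip: exp_add)
    also have "\<dots> = (?E m 1 * mn m) * exp (2 * S (Suc m))" by (simp only: mult_ac)
    also have "\<dots> \<le> mn (Suc m) * exp (2 * S (Suc m))"
      using le by (rule mult_right_mono) simp
    finally show "mn m * exp (2 * S m) \<le> mn (Suc m) * exp (2 * S (Suc m))" .
  qed
  have bnd: "mn m * exp (2 * S m) \<le> mx 0 * exp (3 * s)" for m
  proof -
    have "mn m \<le> mx m" using mn_le[of 0 m] mx_ge[of 0 m] by linarith
    also have "mx m = mx m * exp (- S m) * exp (S m)" by (simp add: exp_minus)
    also have "\<dots> \<le> mx 0 * exp (- S 0) * exp (S m)"
      using decseqD[OF dec, of 0 m] by (intro mult_right_mono) auto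
    finally have "mn m \<le> mx 0 * exp (S m)" by (simp add: S_def)
    then have "mn m * exp (2 * S m) \<le> mx 0 * exp (S m) * exp (2 * S m)"
      by (rule mult_right_mono) simp
    also have "\<dots> = mx 0 * exp (3 * S m)" by (simp flip: exp_add)
    also have "\<dots> \<le> mx 0 * exp (3 * s)"
      using S_le mx_pos[of 0] by simp
    finally show ?thesis .
  qed
  obtain L' where L': "(\<lambda>m. mn m * exp (2 * S m)) \<longlonglongrightarrow> L'" "\<And>m. mn m * exp (2 * S m) \<le> L'"
    using incseq_convergent[OF inc] bnd by blast
  define U where "U = U' * exp s"
  define L where "L = L' * exp (- 2 * s)"
  have "(\<lambda>m. mx m * exp (- S m) * exp (S m)) \<longlonglongrightarrow> U"
    unfolding U_def by (intro tendsto_intros U' S_lim)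
  then have mx_lim: "mx \<longlonglongrightarrow> U" by (simp add: mult.assoc flip: exp_add)
  have "(\<lambda>m. mn m * exp (2 * S m) * exp (- 2 * S m)) \<longlonglongrightarrow> L"
    unfolding L_def by (intro tendsto_intros L' S_lim)
  then have mn_lim: "mn \<longlonglongrightarrow> L" by (simp add: mult.assoc flip: exp_add)
  have "L' > 0" using L'(2)[of 0] mn_pos[of 0] by (meson less_le_trans mult_pos_pos exp_gt_zero)
  then have "L > 0" by (simp add: L_def)
  \<comment> \<open>\<open>window\<close> is applied from an index of the maximum to an index of the
    minimum \<open>k + 1\<close> steps later; in the limit this forces
    \<open>U \<le> L\<close>.\<close>
  have "mn (m + Suc k) \<ge> ?E m (Suc k) * (mn m + \<delta> ^ Suc k * (mx m - mn m))" for m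
    using window mx_at[of m] mn_at[of "m + Suc k"] by (metis le_SucI trans_le_add2)
  moreover have "(\<lambda>m. mn (m + Suc k)) \<longlonglongrightarrow> L" using mn_lim by (rule LIMSEQ_ignore_initial_segment)
  moreover have "(\<lambda>m. ?E m (Suc k) * (mn m + \<delta> ^ Suc k * (mx m - mn m)))
      \<longlonglongrightarrow> exp (- 2 * (s - s)) * (L + \<delta> ^ Suc k * (U - L))"
    by (intro tendsto_intros mx_lim mn_lim S_lim LIMSEQ_ignore_initial_segment)
  ultimately have "exp (- 2 * (s - s)) * (L + \<delta> ^ Suc k * (U - L)) \<le> L"
    by (intro LIMSEQ_le[rotated]) auto
  then have "\<delta> ^ Suc k * (U - L) \<le> 0" by simp
  then have "U \<le> L" using zero_less_power[OF delta, of "Suc k"] by (simp add: mult_le_0_iff del: power_Suc)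
  moreover have "L \<le> U"
    using mn_le[of 0] mx_ge[of 0] by (intro LIMSEQ_le[OF mn_lim mx_lim]) (auto intro: order_trans)
  ultimately have "U = L" by simp
  have "(\<lambda>m. r m j) \<longlonglongrightarrow> L" if "j \<le> k" for j
    by (rule tendsto_sandwich[OF _ _ mn_lim mx_lim[unfolded \<open>U = L\<close>]]) (use that mn_le mx_ge in auto)
  then show ?thesis using \<open>L > 0\<close> by blast
qed

section \<open>Perron vectors of the transfer matrix\<close>

definition angle :: "nat \<Rightarrow> real" where
  "angle k = pi / (real k + 3)"

definition perron :: "nat \<Rightarrow> real" where
  "perron k = 4 * (cos (angle k))\<^sup>2"

definition exponent :: "nat \<Rightarrow> real" where
  "exponent k = - real k / 2 - 1 / (real k + 3)
     - (1 / 4 - 1 / (real k + 3)) * (1 / (cos (angle k))\<^sup>2)"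

definition transfer :: "nat \<Rightarrow> nat \<Rightarrow> real" where
  "transfer j i = (if i \<le> Suc j then 1 else 0)"

text \<open>
  The coefficients of \<open>1 / p\<close> when \<open>chain_step p\<close> is written in the coordinates \<open>f j / (p! * p ^ j)\<close>;
  the leading coefficients are those of \<open>transfer\<close>.
\<close>

definition correction :: "nat \<Rightarrow> nat \<Rightarrow> real" where
  "correction j i = - real i * transfer j i - (if i < j then 1 else 0)"

text \<open>Subtracting consecutive rows of the eigenvector equation gives
  \<open>w (j + 1) = \<lambda> * (w j - w (j - 1))\<close>, whose characteristic roots have modulus
  \<open>2 * cos \<phi>\<close> and arguments \<phi> and -\<phi>. The first and last rows ask for
  zeros at -2 and \<open>k + 1\<close>, whence the offset 2 and the angle.\<close>

definition right_vec :: "nat \<Rightarrow> nat \<Rightarrow> real" where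
  "right_vec k j = (2 * cos (angle k)) ^ j * sin (real (j + 2) * angle k)"

lemma angle_mult: "real (k + 3) * angle k = pi"
  by (simp add: angle_def field_simps)

lemma angle_bounds: "0 < angle k" "angle k < pi / 2"
  using pi_gt_zero by (simp_all add: angle_def field_simps add_pos_nonneg)

lemma cos_angle_pos: "cos (angle k) > 0"
  using angle_bounds by (intro cos_gt_zero) auto

lemma sin_angle_pos: "sin (angle k) > 0"
  using angle_bounds[of k] by (intro sin_gt_zero) auto

lemma perron_pos: "perron k > 0"
  using cos_angle_pos[of k] by (simp add: perron_def)

lemma right_vec_pos: "j \<le> k \<Longrightarrow> right_vec k j > 0"
proof -
  assume "j \<le> k"
  then have "real (j + 2) * angle k < real (k + 3) * angle k"
    using angle_bounds by (intro mult_strict_right_mono) auto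
  then have "real (j + 2) * angle k < pi" unfolding angle_mult .
  then have "sin (real (j + 2) * angle k) > 0"
    using angle_bounds[of k] by (intro sin_gt_zero) auto
  then show ?thesis using cos_angle_pos by (simp add: right_vec_def)
qed

lemma sum_right_vec: "(\<Sum>i<j. right_vec k i) = (2 * cos (angle k)) ^ j * sin (real j * angle k)"
proof (induction j)
  case 0
  then show ?case by simp
next
  case (Suc j)
  let ?a = "angle k"
  have "sin (real j * ?a) + sin (real (j + 2) * ?a) = 2 * cos ?a * sin (real (Suc j) * ?a)"
    using sin_add[of "real (Suc j) * ?a" ?a] sin_diff[of "real (Suc j) * ?a" ?a]
    by (simp add: algebra_simps)
  then show ?case using Suc
    by (simp add: right_vec_def algebra_simps flip: distrib_left)
qed

lemma transfer_right_vec: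
  assumes "j \<le> k"
  shows "(\<Sum>i\<le>k. transfer j i * right_vec k i) = perron k * right_vec k j"
proof -
  \<comment> \<open>The last row has no superdiagonal entry; since the vector vanishes at
    \<open>Suc k\<close>, one may be added.\<close>
  have "right_vec k (Suc k) = 0"
    using angle_mult[of k] by (simp add: right_vec_def add.commute)
  then have "(\<Sum>i\<le>k. transfer j i * right_vec k i) = (\<Sum>i\<le>Suc k. transfer j i * right_vec k i)"
    by simp
  also have "\<dots> = (\<Sum>i\<in>{..<j + 2}. right_vec k i)"
    using assms by (intro sum.mono_neutral_cong_right) (auto simp: transfer_def)
  also have "\<dots> = perron k * right_vec k j"
    unfolding sum_right_vec by (simp add: right_vec_def perron_def power2_eq_square)
  finally show ?thesis .
qed

lemma sum_reverse: "(\<Sum>j\<le>k. f (k - j)) = (\<Sum>j\<le>k. f j)" for f :: "nat \<Rightarrow> real"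
  by (rule sum.reindex_bij_witness[of _ "\<lambda>j. k - j" "\<lambda>j. k - j"]) auto

text \<open>Reversing the indices transposes the transfer matrix, so \<open>\<lambda>j. right_vec k (k - j)\<close> is a
  left eigenvector.\<close>

lemma left_vec_transfer:
  assumes "i \<le> k"
  shows "(\<Sum>j\<le>k. right_vec k (k - j) * transfer j i) = perron k * right_vec k (k - i)"
proof -
  have "(\<Sum>j\<le>k. right_vec k (k - j) * transfer j i)
      = (\<Sum>j\<le>k. right_vec k (k - (k - j)) * transfer (k - j) i)"
    by (rule sum_reverse[symmetric])
  also have "\<dots> = (\<Sum>j\<le>k. transfer (k - i) j * right_vec k j)"
    using assms by (intro sum.cong) (auto simp: transfer_def)
  finally show ?thesis using transfer_right_vec[of "k - i" k] by simp
qed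

text \<open>Reversing the index replaces the angle by its supplement, so entrywise products with
  \<open>right_vec\<close> become a constant times products of neighbouring sines.\<close>

lemma left_vec_eq:
  assumes "j \<le> k"
  shows "right_vec k (k - j) = (2 * cos (angle k)) ^ (k - j) * sin (real (j + 1) * angle k)"
proof -
  have "real (k - j + 2) * angle k = pi - real (j + 1) * angle k"
    using angle_mult[of k] assms by (simp add: of_nat_diff algebra_simps)
  then show ?thesis unfolding right_vec_def by simp
qed

section \<open>Pairings of the left and right Perron vectors\<close>

lemma sum_sin_mult_sin:
  fixes a :: real
  shows "4 * sin a * (\<Sum>i<n. sin (real i * a) * sin (real (i + 1) * a)) =
    2 * real n * cos a * sin a - sin (2 * real n * a)"
proof (induction n)
  case 0
  then show ?case by simp
next
  case (Suc n)
  let ?x = "real n * a"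
  \<comment> \<open>The factor \<open>sin a\<close> makes the sum telescope: each summand is a
    constant minus an increment of \<open>sin (2 * real n * a)\<close>.\<close>
  have "4 * sin a * (sin ?x * sin (?x + a)) = 2 * cos a * sin a - sin (2 * (?x + a)) + sin (2 * ?x)"
  proof -
    have s: "sin ?x * sin ?x = 1 - cos ?x * cos ?x" "sin a * sin a = 1 - cos a * cos a"
      using sin_cos_squared_add[of ?x] sin_cos_squared_add[of a] by (simp_all add: power2_eq_square)
    show ?thesis
      unfolding sin_double sin_add cos_add using s by algebra
  qed
  moreover have "?x + a = real (n + 1) * a" "2 * ?x = 2 * real n * a"
    "2 * (?x + a) = 2 * real (Suc n) * a"
    by (simp_all add: algebra_simps)
  ultimately have "4 * sin a * (sin ?x * sin (real (n + 1) * a)) =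
      2 * cos a * sin a - sin (2 * real (Suc n) * a) + sin (2 * real n * a)" by metis
  then show ?case using Suc by (simp add: algebra_simps)
qed

lemma split_power_product:
  fixes c x y :: real
  assumes "j \<le> k"
  shows "c ^ (k - j) * x * (c ^ j * y) = c ^ k * (x * y)"
proof -
  have "c ^ (k - j) * x * (c ^ j * y) = c ^ (k - j) * c ^ j * (x * y)" by (simp only: mult_ac)
  also have "c ^ (k - j) * c ^ j = c ^ k" using assms by (simp flip: power_add)
  finally show ?thesis .
qed

lemma left_right_product:
  "(\<Sum>j\<le>k. right_vec k (k - j) * right_vec k j) =
    (2 * cos (angle k)) ^ k * (real (k + 3) * cos (angle k) / 2)"
proof -
  let ?a = "angle k"
  let ?g = "\<lambda>i. sin (real i * ?a) * sin (real (i + 1) * ?a)"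
  have "(\<Sum>j\<le>k. right_vec k (k - j) * right_vec k j) = (\<Sum>j\<le>k. (2 * cos ?a) ^ k * ?g (Suc j))"
  proof (intro sum.cong refl)
    fix j
    assume "j \<in> {..k}"
    then have "j \<le> k" by simp
    show "right_vec k (k - j) * right_vec k j = (2 * cos ?a) ^ k * ?g (Suc j)"
      unfolding left_vec_eq[OF \<open>j \<le> k\<close>] unfolding right_vec_def split_power_product[OF \<open>j \<le> k\<close>] by simp
  qed
  also have "\<dots> = (2 * cos ?a) ^ k * (\<Sum>j<k + 1. ?g (Suc j))"
    by (simp add: sum_distrib_left lessThan_Suc_atMost)
  \<comment> \<open>The summands at 0 and \<open>k + 2\<close> vanish. Adding them gives length
    \<open>k + 3\<close>, where the last sine in \<open>sum_sin_mult_sin\<close> is that of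
    \<open>2 * pi\<close>.\<close>
  also have "(\<Sum>j<k + 1. ?g (Suc j)) = (\<Sum>j<k + 2. ?g j)"
    using sum.lessThan_Suc_shift[of ?g "k + 1"] by simp
  also have "\<dots> = (\<Sum>j<k + 3. ?g j)"
    using angle_mult[of k] by (simp add: numeral_3_eq_3 algebra_simps)
  also have "\<dots> = real (k + 3) * cos ?a / 2"
  proof -
    have "2 * real (k + 3) * ?a = 2 * pi" using angle_mult[of k] by (simp only: mult.assoc)
    then have "4 * sin ?a * (\<Sum>j<k + 3. ?g j) = 2 * real (k + 3) * cos ?a * sin ?a"
      using sum_sin_mult_sin[of ?a "k + 3"] by (simp only: sin_two_pi) 
    then have "sin ?a * (2 * (\<Sum>j<k + 3. ?g j) - real (k + 3) * cos ?a) = 0" by algebra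
    then show ?thesis using sin_angle_pos[of k] by simp
  qed
  finally show ?thesis .
qed

text \<open>This pairs the part of \<open>correction\<close> that comes from excluding repeated
  cherries.\<close>

lemma left_below_product:
  "(\<Sum>j\<le>k. right_vec k (k - j) * (\<Sum>i<j. right_vec k i)) =
    (2 * cos (angle k)) ^ k * (cos (angle k) / 2 * (real (k + 3) - 4 * (sin (angle k))\<^sup>2))"
proof -
  let ?a = "angle k"
  let ?g = "\<lambda>i. sin (real i * ?a) * sin (real (i + 1) * ?a)"
  have "(\<Sum>j\<le>k. right_vec k (k - j) * (\<Sum>i<j. right_vec k i)) = (\<Sum>j\<le>k. (2 * cos ?a) ^ k * ?g j)"
  proof (intro sum.cong refl)
    fix j
    assume "j \<in> {..k}"
    then have "j \<le> k" by simp
    show "right_vec k (k - j) * (\<Sum>i<j. right_vec k i) = (2 * cos ?a) ^ k * ?g j"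
      unfolding left_vec_eq[OF \<open>j \<le> k\<close>] sum_right_vec split_power_product[OF \<open>j \<le> k\<close>] by simp
  qed
  also have "\<dots> = (2 * cos ?a) ^ k * (\<Sum>j<k + 1. ?g j)"
    by (simp add: sum_distrib_left lessThan_Suc_atMost)
  also have "(\<Sum>j<k + 1. ?g j) = cos ?a / 2 * (real (k + 3) - 4 * (sin ?a)\<^sup>2)"
  proof -
    have "2 * real (k + 1) * ?a = 2 * pi - 2 * (2 * ?a)" using angle_mult[of k] by (simp add: algebra_simps)
    then have "sin (2 * real (k + 1) * ?a) = - sin (2 * (2 * ?a))"
      by (simp only: sin_2pi_minus)
    also have "sin (2 * (2 * ?a)) = 2 * (2 * sin ?a * cos ?a) * (1 - 2 * (sin ?a)\<^sup>2)"
      by (simp only: sin_double cos_double_sin)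
    finally have "sin (2 * real (k + 1) * ?a) = - (2 * (2 * sin ?a * cos ?a) * (1 - 2 * (sin ?a)\<^sup>2))" .
    then have "4 * sin ?a * (\<Sum>j<k + 1. ?g j) =
        4 * sin ?a * (cos ?a / 2 * (real (k + 3) - 4 * (sin ?a)\<^sup>2))"
      using sum_sin_mult_sin[of ?a "k + 1"] by (simp add: algebra_simps)
    then show ?thesis using sin_angle_pos[of k] by (simp only: mult_cancel_left) simp
  qed
  finally show ?thesis .
qed

text \<open>The entrywise product is symmetric under reversal of the index, so its mean index is
  \<open>k / 2\<close>.\<close>

lemma left_index_product:
  "(\<Sum>j\<le>k. real j * (right_vec k (k - j) * right_vec k j)) =
    real k / 2 * (\<Sum>j\<le>k. right_vec k (k - j) * right_vec k j)"
proof -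
  let ?h = "\<lambda>j. right_vec k (k - j) * right_vec k j"
  have "(\<Sum>j\<le>k. real j * ?h j) = (\<Sum>j\<le>k. real (k - j) * ?h (k - j))"
    by (rule sum_reverse[symmetric])
  also have "\<dots> = (\<Sum>j\<le>k. real k * ?h j - real j * ?h j)"
    by (intro sum.cong) (auto simp: of_nat_diff algebra_simps)
  also have "\<dots> = real k * (\<Sum>j\<le>k. ?h j) - (\<Sum>j\<le>k. real j * ?h j)"
    by (simp add: sum_subtractf sum_distrib_left)
  finally show ?thesis by simp
qed

text \<open>This identity fixes the exponent. In the part \<open>- i * transfer j i\<close> the left
  vector turns \<open>transfer\<close> into the factor \<open>perron k\<close>, leaving a mean
  index; the other part is \<open>left_below_product\<close>.\<close>

lemma left_correction_right:
  "(\<Sum>j\<le>k. right_vec k (k - j) * (\<Sum>i\<le>k. correction j i * right_vec k i)) =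
    perron k * exponent k * (\<Sum>j\<le>k. right_vec k (k - j) * right_vec k j)"
proof -
  let ?u = "\<lambda>j. right_vec k (k - j)" and ?w = "right_vec k"
  have row: "(\<Sum>i\<le>k. correction j i * ?w i) =
      - (\<Sum>i\<le>k. transfer j i * (real i * ?w i)) - (\<Sum>i<j. ?w i)" if "j \<le> k" for j
  proof -
    have "(\<Sum>i\<le>k. (if i < j then 1 else 0) * ?w i) = (\<Sum>i<j. ?w i)"
      using that by (intro sum.mono_neutral_cong_right) auto
    moreover have "correction j i * ?w i =
        - (transfer j i * (real i * ?w i)) - (if i < j then 1 else 0) * ?w i" for i
      unfolding correction_def by (simp add: algebra_simps)
    ultimately show ?thesis by (simp add: sum_subtractf sum_negf)
  qed
  have "(\<Sum>j\<le>k. ?u j * (\<Sum>i\<le>k. correction j i * ?w i)) =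
      - (\<Sum>j\<le>k. ?u j * (\<Sum>i\<le>k. transfer j i * (real i * ?w i))) - (\<Sum>j\<le>k. ?u j * (\<Sum>i<j. ?w i))"
    by (simp add: row right_diff_distrib sum_subtractf sum_negf)
  also have "(\<Sum>j\<le>k. ?u j * (\<Sum>i\<le>k. transfer j i * (real i * ?w i)))
      = (\<Sum>i\<le>k. (\<Sum>j\<le>k. ?u j * transfer j i) * (real i * ?w i))"
    by (simp add: sum_distrib_left sum_distrib_right mult.assoc) (rule sum.swap)
  also have "\<dots> = (\<Sum>i\<le>k. perron k * (real i * (?u i * ?w i)))"
    by (intro sum.cong) (auto simp: left_vec_transfer)
  also have "\<dots> = perron k * (real k / 2 * (\<Sum>j\<le>k. ?u j * ?w j))"
    unfolding left_index_product[symmetric] by (simp add: sum_distrib_left)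
  finally have *: "(\<Sum>j\<le>k. ?u j * (\<Sum>i\<le>k. correction j i * ?w i)) =
      - (perron k * (real k / 2 * (\<Sum>j\<le>k. ?u j * ?w j))) - (\<Sum>j\<le>k. ?u j * (\<Sum>i<j. ?w i))" .
  let ?c = "cos (angle k)"
  have c: "?c \<noteq> 0" using cos_angle_pos[of k] by simp
  have s: "(sin (angle k))\<^sup>2 = 1 - ?c\<^sup>2" by (rule sin_squared_eq)
  let ?K = "real (k + 3)"
  have K: "?K \<noteq> 0" by simp
  have "perron k * exponent k = - (perron k * (real k / 2)) - (1 - 4 * (1 - ?c\<^sup>2) / ?K)"
  proof -
    have "4 * ?c\<^sup>2 * ((1 / 4 - 1 / ?K) * (1 / ?c\<^sup>2)) = 1 - 4 / ?K" using c by simp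
    then show ?thesis unfolding perron_def exponent_def by (simp add: algebra_simps diff_divide_distrib)
  qed
  then have "perron k * exponent k * (?K * ?c / 2) =
      - (perron k * (real k / 2)) * (?K * ?c / 2) - (1 - 4 * (1 - ?c\<^sup>2) / ?K) * (?K * ?c / 2)"
    by (simp only: left_diff_distrib)
  also have "(1 - 4 * (1 - ?c\<^sup>2) / ?K) * (?K * ?c / 2) = ?c / 2 * (?K - 4 * (sin (angle k))\<^sup>2)"
    unfolding s using K by (simp add: field_simps)
  finally have e: "perron k * exponent k * (?K * ?c / 2) =
      - (perron k * (real k / 2)) * (?K * ?c / 2) - ?c / 2 * (?K - 4 * (sin (angle k))\<^sup>2)" .
  have cancel: "- (p * (h * (D * Y))) - D * Z = q * (D * Y)" if "q * Y = - (p * h) * Y - Z"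
    for p h D Y Z q :: real
    using that by algebra
  show ?thesis
    unfolding * left_right_product left_below_product by (rule cancel[OF e])
qed

text \<open>All superdiagonal entries of \<open>transfer\<close> are 1, so all rows but the last can be solved one by one.\<close>

lemma hessenberg_partial_solution:
  fixes g :: "nat \<Rightarrow> real"
  shows "\<exists>x. \<forall>j<n. (\<Sum>i\<le>Suc j. x i) - l * x j = g j"
proof (induction n)
  case 0
  then show ?case by simp
next
  case (Suc n)
  then obtain x where x: "\<And>j. j < n \<Longrightarrow> (\<Sum>i\<le>Suc j. x i) - l * x j = g j" by blast
  let ?y = "x(Suc n := g n + l * x n - (\<Sum>i\<le>n. x i))"
  have "(\<Sum>i\<le>Suc j. ?y i) - l * ?y j = g j" if "j < Suc n" for j
  proof (cases "j = n")
    case True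
    have "(\<Sum>i\<le>n. ?y i) = (\<Sum>i\<le>n. x i)" by (intro sum.cong) auto
    then show ?thesis using True by simp
  next
    case False
    then have "(\<Sum>i\<le>Suc j. ?y i) = (\<Sum>i\<le>Suc j. x i)" using that by (intro sum.cong) auto
    then show ?thesis using x[of j] False that by simp
  qed
  then show ?case by blast
qed

text \<open>A Fredholm alternative: once all rows but the last are solved, the residual lives in row
  \<open>k\<close>. Its pairing with the left eigenvector is zero, and that vector is positive
  there.\<close>

lemma transfer_solvable:
  assumes "(\<Sum>j\<le>k. right_vec k (k - j) * g j) = 0"
  shows "\<exists>x. \<forall>j\<le>k. (\<Sum>i\<le>k. transfer j i * x i) = perron k * x j + g j"
proof -
  let ?u = "\<lambda>j. right_vec k (k - j)"
  obtain x where x: "\<And>j. j < k \<Longrightarrow> (\<Sum>i\<le>Suc j. x i) - perron k * x j = g j"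
    using hessenberg_partial_solution[of k "perron k" g] by blast
  define d where "d j = (\<Sum>i\<le>k. transfer j i * x i) - perron k * x j - g j" for j
  have low: "d j = 0" if "j < k" for j
  proof -
    have "(\<Sum>i\<le>k. transfer j i * x i) = (\<Sum>i\<le>Suc j. x i)"
      using that by (intro sum.mono_neutral_cong_right) (auto simp: transfer_def)
    then show ?thesis using x[OF that] by (simp add: d_def)
  qed
  have "(\<Sum>j\<le>k. ?u j * d j) = (\<Sum>j\<le>k. ?u j * (\<Sum>i\<le>k. transfer j i * x i))
      - perron k * (\<Sum>j\<le>k. ?u j * x j) - (\<Sum>j\<le>k. ?u j * g j)"
    by (simp add: d_def right_diff_distrib sum_subtractf sum_distrib_left mult_ac)
  also have "(\<Sum>j\<le>k. ?u j * (\<Sum>i\<le>k. transfer j i * x i)) = (\<Sum>i\<le>k. (\<Sum>j\<le>k. ?u j * transfer j i) * x i)"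
    by (simp add: sum_distrib_left sum_distrib_right mult.assoc) (rule sum.swap)
  also have "\<dots> = perron k * (\<Sum>j\<le>k. ?u j * x j)"
    by (simp add: left_vec_transfer sum_distrib_left mult.assoc)
  finally have "(\<Sum>j\<le>k. ?u j * d j) = 0" using assms by simp
  moreover have "(\<Sum>j\<le>k. ?u j * d j) = ?u k * d k"
    using low by (simp add: lessThan_Suc_atMost[symmetric])
  ultimately have "d k = 0" using right_vec_pos[of 0 k] by simp
  then have "d j = 0" if "j \<le> k" for j using low that by (cases "j = k") auto
  then show ?thesis unfolding d_def by (intro exI[of _ x]) (simp add: algebra_simps)
qed

section \<open>First-order expansions\<close>

definition expands :: "(nat \<Rightarrow> real) \<Rightarrow> real \<Rightarrow> real \<Rightarrow> bool" where
  "expands f a b \<longleftrightarrow> (\<lambda>n. f n - (a + b / real n)) \<in> O(\<lambda>n. 1 / real n ^ 2)"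

lemma expands_const: "expands (\<lambda>n. c) c 0"
  unfolding expands_def by simp

lemma expands_tendsto:
  assumes "expands f a b"
  shows "f \<longlonglongrightarrow> a"
proof -
  have "(\<lambda>n. 1 / real n ^ 2) \<in> o(\<lambda>_. 1)" by real_asymp
  then have "(\<lambda>n. f n - (a + b / real n)) \<in> o(\<lambda>_. 1)"
    using assms unfolding expands_def by (rule landau_o.big_small_trans[rotated])
  from smalloD_tendsto[OF this] have "(\<lambda>n. f n - (a + b / real n)) \<longlonglongrightarrow> 0" by simp
  moreover have "(\<lambda>n. a + b / real n) \<longlonglongrightarrow> a" by real_asymp
  ultimately have "(\<lambda>n. f n - (a + b / real n) + (a + b / real n)) \<longlonglongrightarrow> 0 + a"
    by (rule tendsto_add)
  then show ?thesis by simp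
qed

lemma expands_add:
  assumes "expands f a b" "expands g a' b'"
  shows "expands (\<lambda>n. f n + g n) (a + a') (b + b')"
proof -
  have "(\<lambda>n. (f n - (a + b / real n)) + (g n - (a' + b' / real n))) \<in> O(\<lambda>n. 1 / real n ^ 2)"
    using assms unfolding expands_def by (rule sum_in_bigo)
  then show ?thesis unfolding expands_def by (simp add: algebra_simps add_divide_distrib)
qed

lemma expands_mult:
  assumes "expands f a b" "expands g a' b'"
  shows "expands (\<lambda>n. f n * g n) (a * a') (a * b' + b * a')"
proof -
  let ?o = "\<lambda>n. 1 / real n ^ 2"
  have "f \<in> O(\<lambda>_. 1)" using expands_tendsto[OF assms(1)] by (intro bigoI_tendsto) auto
  then have "(\<lambda>n. f n * (g n - (a' + b' / real n))) \<in> O(\<lambda>n. 1 * ?o n)"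
    using assms(2) unfolding expands_def by (rule landau_o.big.mult)
  moreover have "(\<lambda>n. a' + b' / real n) \<in> O(\<lambda>_. 1)" by real_asymp
  then have "(\<lambda>n. (a' + b' / real n) * (f n - (a + b / real n))) \<in> O(\<lambda>n. 1 * ?o n)"
    using assms(1) unfolding expands_def by (rule landau_o.big.mult)
  moreover have "(\<lambda>n. b * b' / real n ^ 2) \<in> O(?o)"
    by (simp add: divide_inverse landau_o.big.cmult_in_iff)
  ultimately have "(\<lambda>n. f n * (g n - (a' + b' / real n)) + (a' + b' / real n) * (f n - (a + b / real n))
      + b * b' / real n ^ 2) \<in> O(?o)"
    by (intro sum_in_bigo) simp_all
  also have "(\<lambda>n. f n * (g n - (a' + b' / real n)) + (a' + b' / real n) * (f n - (a + b / real n))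
      + b * b' / real n ^ 2) = (\<lambda>n. f n * g n - (a * a' + (a * b' + b * a') / real n))"
    by (rule ext) (simp add: algebra_simps add_divide_distrib power2_eq_square)
  finally show ?thesis unfolding expands_def .
qed

lemma expands_sum:
  assumes "\<And>i. i \<in> I \<Longrightarrow> expands (f i) (a i) (b i)" "finite I"
  shows "expands (\<lambda>n. \<Sum>i\<in>I. f i n) (\<Sum>i\<in>I. a i) (\<Sum>i\<in>I. b i)"
  using assms(2,1)
proof (induction I rule: finite_induct)
  case empty
  then show ?case using expands_const[of 0] by simp
next
  case (insert x I)
  then show ?case using expands_add[of "f x" "a x" "b x"] by simp
qed

lemma expands_shift:
  assumes "expands f a b"
  shows "expands (\<lambda>n. f (Suc n)) a b"
proof -
  have "filterlim Suc at_top (at_top :: nat filter)" by (rule filterlim_Suc)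
  then have "(\<lambda>n. f (Suc n) - (a + b / real (Suc n))) \<in> O(\<lambda>n. 1 / real (Suc n) ^ 2)"
    using assms unfolding expands_def by (rule landau_o.big.compose[rotated])
  also have "(\<lambda>n. 1 / real (Suc n) ^ 2) \<in> O(\<lambda>n. 1 / real n ^ 2)" by real_asymp
  finally have "(\<lambda>n. f (Suc n) - (a + b / real (Suc n))) \<in> O(\<lambda>n. 1 / real n ^ 2)" .
  moreover have "(\<lambda>n. b * (1 / real (Suc n) - 1 / real n)) \<in> O(\<lambda>n. 1 / real n ^ 2)"
    by real_asymp
  ultimately have "(\<lambda>n. (f (Suc n) - (a + b / real (Suc n))) + b * (1 / real (Suc n) - 1 / real n))
      \<in> O(\<lambda>n. 1 / real n ^ 2)"
    by (rule sum_in_bigo)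
  then show ?thesis unfolding expands_def by (simp add: algebra_simps)
qed

text \<open>The common terms cancel in \<open>f n - g n\<close>. For the row sums this yields a
  summable deviation from 1.\<close>

lemma expands_ratio:
  assumes "expands f a b" "expands g a b" "a \<noteq> 0"
  shows "(\<lambda>n. f n / g n - 1) \<in> O(\<lambda>n. 1 / real n ^ 2)"
proof -
  have g: "g \<longlonglongrightarrow> a" using assms(2) by (rule expands_tendsto)
  then have "eventually (\<lambda>n. g n \<noteq> 0) at_top" using assms(3) by (rule tendsto_imp_eventually_ne)
  then have eq: "eventually (\<lambda>n. (f n - g n) * inverse (g n) = f n / g n - 1) at_top"
    by eventually_elim (simp add: field_simps)
  have "(\<lambda>n. inverse (g n)) \<in> O(\<lambda>_. 1)"
    using tendsto_inverse[OF g assms(3)] by (intro bigoI_tendsto) auto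
  moreover have "(\<lambda>n. (f n - (a + b / real n)) - (g n - (a + b / real n))) \<in> O(\<lambda>n. 1 / real n ^ 2)"
    using assms(1,2) unfolding expands_def by (rule sum_in_bigo)
  ultimately have "(\<lambda>n. (f n - g n) * inverse (g n)) \<in> O(\<lambda>n. 1 / real n ^ 2 * 1)"
    by (intro landau_o.big.mult) simp_all
  then show ?thesis using landau_o.big.in_cong[OF eq] by simp
qed

lemma expands_ratio_power: "expands (\<lambda>n. (real n / (real n + 1)) ^ i) 1 (- real i)"
proof (induction i)
  case 0
  then show ?case using expands_const[of 1] by simp
next
  case (Suc i)
  have "expands (\<lambda>n. real n / (real n + 1)) 1 (- 1)"
    unfolding expands_def by real_asymp
  from expands_mult[OF this Suc] show ?case by (simp add: algebra_simps)
qed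

lemma expands_cherry: "expands (\<lambda>n. (real n ^ 2 + real n + 1) / (real n + 1) ^ 2) 1 (- 1)"
  unfolding expands_def by real_asymp

lemma expands_growth: "expands (\<lambda>n. (1 + 1 / real n) powr c) 1 c"
  unfolding expands_def by real_asymp

section \<open>Asymptotics\<close>

text \<open>These are the exact entries whose expansion is \<open>transfer\<close> plus
  \<open>correction / p\<close>. The power comes from replacing \<open>p ^ i\<close> by
  \<open>(p + 1) ^ i\<close>, the last factor is the share of new cherries among all pairs of
  pointers.\<close>

definition step_coeff :: "nat \<Rightarrow> nat \<Rightarrow> nat \<Rightarrow> real" where
  "step_coeff p j i = transfer j i * (real p / (real p + 1)) ^ i *
    (if i < j then (real p ^ 2 + real p + 1) / (real p + 1) ^ 2 else 1)"

lemma step_coeff_nonneg: "step_coeff p j i \<ge> 0"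
  by (simp add: step_coeff_def transfer_def)

lemma expands_step_coeff: "expands (\<lambda>p. step_coeff p j i) (transfer j i) (correction j i)"
proof -
  have "expands (\<lambda>p. if i < j then (real p ^ 2 + real p + 1) / (real p + 1) ^ 2 else 1)
      1 (if i < j then - 1 else 0)"
    using expands_cherry expands_const[of 1] by auto
  from expands_mult[OF expands_mult[OF expands_const[of "transfer j i"] expands_ratio_power[of i]] this]
  have "expands (\<lambda>p. step_coeff p j i) (transfer j i)
      (transfer j i * (if i < j then - 1 else 0) - transfer j i * real i)"
    by (simp add: step_coeff_def)
  moreover have "transfer j i * (if i < j then - 1 else 0) - transfer j i * real i = correction j i"
    by (simp add: correction_def transfer_def)
  ultimately show ?thesis by simp
qed

lemma chain_step_scaled:
  assumes "p > 0" "j \<le> k" "f (Suc k) = 0"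
  shows "real (chain_step p f j) / (fact (Suc p) * real (Suc p) ^ j) =
    (\<Sum>i\<le>k. step_coeff p j i * (real (f i) / (fact p * real p ^ i)))"
proof -
  let ?t = "\<lambda>i. step_coeff p j i * (real (f i) / (fact p * real p ^ i))"
  let ?D = "fact (Suc p) * real (Suc p) ^ j"
  define F S where "F = (fact p :: real)" and "S = 1 + real p"
  have FS: "F \<noteq> 0" "S \<noteq> 0" by (simp_all add: F_def S_def)
  have D_eq: "?D = S * F * S ^ j" by (simp add: F_def S_def)
  have scale: "?t i = transfer j i * (if i < j then (real p ^ 2 + real p + 1) / S ^ 2 else 1) *
      (real (f i) / (F * S ^ i))" for i
    using assms(1) by (simp add: step_coeff_def F_def S_def power_divide add.commute[of _ 1] mult_ac)
  have below: "?t i = real ((p + 1) ^ (j - i - 1) * (p\<^sup>2 + p + 1) * f i) / ?D" if i: "i < j" for i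
  proof -
    obtain d where d: "j = i + Suc d" using less_iff_Suc_add[of i j] i by auto
    let ?q = "real p ^ 2 + real p + 1"
    have "?t i = ?q / S ^ 2 * (real (f i) / (F * S ^ i))"
      unfolding scale using i by (simp add: transfer_def)
    also have "\<dots> = S ^ d * ?q * real (f i) / (S * F * S ^ j)"
      using FS unfolding d by (simp add: power_add power2_eq_square)
    also have "S ^ d * ?q * real (f i) = real ((p + 1) ^ (j - i - 1) * (p\<^sup>2 + p + 1) * f i)"
      unfolding d S_def by (simp add: algebra_simps)
    finally show ?thesis unfolding D_eq .
  qed
  have diag: "?t j = real ((p + 1) * f j) / ?D"
  proof -
    have "real ((p + 1) * f j) = S * real (f j)" by (simp add: S_def algebra_simps)
    then show ?thesis unfolding scale D_eq using FS by (simp add: transfer_def)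
  qed
  have above: "?t (Suc j) = real (f (Suc j)) / ?D"
    unfolding scale D_eq using FS by (simp add: transfer_def mult_ac)
  have "(\<Sum>i\<le>k. ?t i) = (\<Sum>i\<le>Suc k. ?t i)" using assms(3) by simp
  also have "\<dots> = (\<Sum>i\<le>Suc j. ?t i)"
    using assms(2) by (intro sum.mono_neutral_right) (auto simp: step_coeff_def transfer_def)
  also have "\<dots> = (\<Sum>i<j. ?t i) + ?t j + ?t (Suc j)"
    by (simp flip: lessThan_Suc_atMost)
  also have "(\<Sum>i<j. ?t i) = real (\<Sum>i<j. (p + 1) ^ (j - i - 1) * (p\<^sup>2 + p + 1) * f i) / ?D"
    using below by (simp add: sum_divide_distrib)
  also have "\<dots> + ?t j + ?t (Suc j) = real (chain_step p f j) / ?D"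
    unfolding diag above chain_step_def by (simp only: of_nat_add add_divide_distrib)
  finally show ?thesis by simp
qed

lemma chain_weight_pos: "j \<le> k \<Longrightarrow> chain_weight k m n j > 0"
proof (induction n arbitrary: j)
  case 0
  then show ?case by simp
next
  case (Suc n)
  then show ?case by (simp add: chain_step_def)
qed

lemma chain_weight_asymptotics:
  "\<exists>c>0. (\<lambda>n. real (chain_weight k 0 n 0) /
     (fact (Suc n) * (perron k ^ Suc n * real (Suc n) powr exponent k))) \<longlonglongrightarrow> c"
proof -
  let ?w = "right_vec k" and ?l = "perron k" and ?\<theta> = "exponent k"
  \<comment> \<open>Comparing coefficients of \<open>1 / p\<close> in \<open>(A + B / p) (w + x / p)
    = \<lambda> (1 + \<theta> / p) (w + x / p)\<close> gives
    \<open>A x = \<lambda> x + g\<close>.\<close>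
  define g where "g j = ?l * ?\<theta> * ?w j - (\<Sum>i\<le>k. correction j i * ?w i)" for j
  have "(\<Sum>j\<le>k. ?w (k - j) * g j) = 0"
    using left_correction_right[of k]
    by (simp add: g_def right_diff_distrib sum_subtractf sum_distrib_left mult_ac)
  then obtain x where x: "\<And>j. j \<le> k \<Longrightarrow> (\<Sum>i\<le>k. transfer j i * x i) = ?l * x j + g j"
    using transfer_solvable[of k g] by blast
  define W where "W p j = ?w j + x j / real p" for p j
  define h where "h p = ?l * (1 + 1 / real p) powr ?\<theta>" for p :: nat
  \<comment> \<open>A step leads to the coordinates of \<open>p + 1\<close>, hence
    \<open>W (Suc p)\<close>; this shift changes only the order
    \<open>1 / p\<^sup>2\<close>.\<close>
  define den where "den p j = W (Suc p) j * h p" for p j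
  define P where "P p j i = step_coeff p j i * W p i / den p j" for p j i
  have W: "expands (\<lambda>p. W p j) (?w j) (x j)" for j
    unfolding expands_def W_def by simp
  have h: "expands h ?l (?l * ?\<theta>)"
    using expands_mult[OF expands_const[of ?l] expands_growth[of ?\<theta>]] by (simp add: h_def[abs_def])
  have den: "expands (\<lambda>p. den p j) (?l * ?w j) (?l * x j + ?l * ?\<theta> * ?w j)" for j
    using expands_mult[OF expands_shift[OF W] h, of j] by (simp add: den_def mult_ac add_ac)
  have num: "expands (\<lambda>p. \<Sum>i\<le>k. step_coeff p j i * W p i) (?l * ?w j) (?l * x j + ?l * ?\<theta> * ?w j)"
    if j: "j \<le> k" for j
  proof -
    have "expands (\<lambda>p. \<Sum>i\<le>k. step_coeff p j i * W p i) (\<Sum>i\<le>k. transfer j i * ?w i)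
        (\<Sum>i\<le>k. transfer j i * x i + correction j i * ?w i)"
      by (intro expands_sum expands_mult expands_step_coeff W) auto
    moreover have "(\<Sum>i\<le>k. transfer j i * x i + correction j i * ?w i) = ?l * x j + ?l * ?\<theta> * ?w j"
      using x[OF j] by (simp add: sum.distrib g_def)
    ultimately show ?thesis using transfer_right_vec[OF j] by simp
  qed
  have lw: "?l * ?w j > 0" if "j \<le> k" for j
    using that perron_pos right_vec_pos by simp
  have row_eq: "(\<Sum>i\<le>k. P p j i) = (\<Sum>i\<le>k. step_coeff p j i * W p i) / den p j" for p j
    by (simp add: P_def sum_divide_distrib)
  have "(\<lambda>p. \<bar>(\<Sum>i\<le>k. P p j i) - 1\<bar>) \<in> O(\<lambda>p. 1 / real p ^ 2)" if "j \<le> k" for j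
    using expands_ratio[OF num[OF that] den less_imp_neq[OF lw[OF that], symmetric]]
    unfolding row_eq by simp
  then have "(\<lambda>p. \<Sum>j\<le>k. \<bar>(\<Sum>i\<le>k. P p j i) - 1\<bar>) \<in> O(\<lambda>p. 1 / real p ^ 2)"
    by (intro big_sum_in_bigo) simp
  then obtain C where C: "C > 0"
      "eventually (\<lambda>p. norm (\<Sum>j\<le>k. \<bar>(\<Sum>i\<le>k. P p j i) - 1\<bar>) \<le> C * norm (1 / real p ^ 2)) at_top"
    by (elim landau_o.bigE)
  have ev_row: "eventually (\<lambda>p. \<forall>j\<le>k. \<bar>(\<Sum>i\<le>k. P p j i) - 1\<bar> \<le> C / real p ^ 2) at_top"
    using C(2)
  proof eventually_elim
    case (elim p)
    have "\<bar>(\<Sum>i\<le>k. P p j i) - 1\<bar> \<le> (\<Sum>j\<le>k. \<bar>(\<Sum>i\<le>k. P p j i) - 1\<bar>)" if "j \<le> k" for j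
      using that by (intro member_le_sum) auto
    then show ?case using elim by fastforce
  qed
  have ev_W: "eventually (\<lambda>p. \<forall>j\<in>{..k}. W p j > 0) at_top"
    using order_tendstoD(1)[OF expands_tendsto[OF W]] right_vec_pos
    by (intro eventually_ball_finite) auto
  \<comment> \<open>Half of the smallest \<open>w i / (\<lambda> * w j)\<close>. For
    \<open>i \<le> Suc j\<close> these quotients are the limits of \<open>P p j i\<close>.\<close>
  define \<delta> where "\<delta> = Min ((\<lambda>(j, i). ?w i / (?l * ?w j) / 2) ` ({..k} \<times> {..k}))"
  have \<delta>: "\<delta> > 0"
    unfolding \<delta>_def using right_vec_pos perron_pos by (subst Min_gr_iff) auto
  have "eventually (\<lambda>p. \<forall>ji\<in>{(j, i). j \<le> k \<and> i \<le> k \<and> i \<le> Suc j}. P p (fst ji) (snd ji) \<ge> \<delta>) at_top"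
  proof (intro eventually_ball_finite ballI)
    show "finite {(j, i). j \<le> k \<and> i \<le> k \<and> i \<le> Suc j}"
      by (rule finite_subset[of _ "{..k} \<times> {..k}"]) auto
    fix ji
    assume "ji \<in> {(j, i). j \<le> k \<and> i \<le> k \<and> i \<le> Suc j}"
    then obtain j i where ji: "ji = (j, i)" "j \<le> k" "i \<le> k" "i \<le> Suc j" by auto
    have "(\<lambda>p. P p j i) \<longlonglongrightarrow> transfer j i * ?w i / (?l * ?w j)"
      unfolding P_def using lw[OF ji(2)]
      by (intro tendsto_divide tendsto_mult expands_tendsto[OF W] expands_tendsto[OF den]
          expands_tendsto[OF expands_step_coeff]) auto
    then have lim: "(\<lambda>p. P p j i) \<longlonglongrightarrow> ?w i / (?l * ?w j)"
      using ji(4) by (simp add: transfer_def)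
    have half: "y / 2 < y" if "y > 0" for y :: real
      using that by simp
    have "\<delta> \<le> ?w i / (?l * ?w j) / 2"
      unfolding \<delta>_def using ji by (intro Min_le) auto
    also have "\<dots> < ?w i / (?l * ?w j)"
      using half[OF divide_pos_pos[OF right_vec_pos[OF ji(3)] lw[OF ji(2)]]] .
    finally have "\<delta> < ?w i / (?l * ?w j)" .
    from order_tendstoD(1)[OF lim this]
    show "eventually (\<lambda>p. P p (fst ji) (snd ji) \<ge> \<delta>) at_top"
      by eventually_elim (simp add: ji(1))
  qed
  moreover have "eventually (\<lambda>p. C / real p ^ 2 \<le> 1 / 2) at_top" by real_asymp
  ultimately have "eventually (\<lambda>p. p \<ge> 1 \<and> (\<forall>j\<in>{..k}. W p j > 0) \<and>
      (\<forall>j\<le>k. \<bar>(\<Sum>i\<le>k. P p j i) - 1\<bar> \<le> C / real p ^ 2) \<and> C / real p ^ 2 \<le> 1 / 2 \<and>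
      (\<forall>ji\<in>{(j, i). j \<le> k \<and> i \<le> k \<and> i \<le> Suc j}. P p (fst ji) (snd ji) \<ge> \<delta>)) at_top"
    (is "eventually ?good at_top")
    using ev_row ev_W eventually_ge_at_top[of 1] by (intro eventually_conj)
  then obtain N where good: "\<And>p. p \<ge> N \<Longrightarrow> ?good p"
    by (auto simp only: eventually_at_top_linorder)
  have N: "p \<ge> 1" "j \<le> k \<Longrightarrow> W p j > 0"
      "j \<le> k \<Longrightarrow> \<bar>(\<Sum>i\<le>k. P p j i) - 1\<bar> \<le> C / real p ^ 2" "C / real p ^ 2 \<le> 1 / 2"
      "j \<le> k \<Longrightarrow> i \<le> k \<Longrightarrow> i \<le> Suc j \<Longrightarrow> P p j i \<ge> \<delta>"
    if "p \<ge> N" for p j i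
    using good[OF that] by auto
  \<comment> \<open>\<open>chain_weight k 0 n\<close> has completed \<open>n + 1\<close> nodes, so
    \<open>p\<close> nodes correspond to the index \<open>p - 1\<close>.\<close>
  define b where "b p j = real (chain_weight k 0 (p - 1) j) / (fact p * real p ^ j)" for p j
  have b_rec: "b (Suc p) j = (\<Sum>i\<le>k. step_coeff p j i * b p i)" if "p \<ge> 1" "j \<le> k" for p j
  proof -
    obtain n where n: "p = Suc n" using \<open>p \<ge> 1\<close> by (cases p) auto
    show ?thesis
      using chain_step_scaled[of p j k "chain_weight k 0 n"] that
      by (simp add: b_def n chain_weight_gt)
  qed
  define G where "G p = ?l ^ p * real p powr ?\<theta>" for p :: nat
  have G_pos: "G p > 0" if "p \<ge> 1" for p
    using that perron_pos[of k] by (simp add: G_def)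
  have G_rec: "G (Suc p) = G p * h p" if "p \<ge> 1" for p
  proof -
    have "real (Suc p) = real p * (1 + 1 / real p)" using that by (simp add: field_simps)
    then have "real (Suc p) powr ?\<theta> = real p powr ?\<theta> * (1 + 1 / real p) powr ?\<theta>"
      by (simp only: powr_mult)
    then show ?thesis by (simp add: G_def h_def)
  qed
  define r where "r m j = b (m + N) j / (W (m + N) j * G (m + N))" for m j
  have h_pos: "h p > 0" for p
  proof -
    have "1 + 1 / real p > 0" by (simp add: add_pos_nonneg)
    then show ?thesis using perron_pos[of k] by (simp add: h_def)
  qed
  have P_nonneg: "P p j i \<ge> 0" if "p \<ge> N" "j \<le> k" "i \<le> k" for p j i
    using N(2)[of p i] N(2)[of "Suc p" j] that h_pos[of p] step_coeff_nonneg[of p j i]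
    by (simp add: P_def den_def)
  have r_rec: "r (Suc m) j = (\<Sum>i\<le>k. P (m + N) j i * r m i)" if j: "j \<le> k" for m j
  proof -
    let ?p = "m + N"
    have p: "?p \<ge> 1" using N(1)[of ?p] by simp
    have "r (Suc m) j = (\<Sum>i\<le>k. step_coeff ?p j i * b ?p i) / (den ?p j * G ?p)"
      using b_rec[OF p j] G_rec[OF p] by (simp add: r_def den_def mult_ac)
    also have "\<dots> = (\<Sum>i\<le>k. step_coeff ?p j i * b ?p i / (den ?p j * G ?p))"
      by (rule sum_divide_distrib)
    also have "\<dots> = (\<Sum>i\<le>k. P ?p j i * r m i)"
    proof (intro sum.cong refl)
      fix i
      assume "i \<in> {..k}"
      then have "W ?p i \<noteq> 0" using N(2)[of ?p i] by simp
      then show "step_coeff ?p j i * b ?p i / (den ?p j * G ?p) = P ?p j i * r m i"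
        by (simp add: P_def r_def)
    qed
    finally show ?thesis .
  qed
  have r_pos: "r 0 j > 0" if "j \<le> k" for j
    using that N(1)[of N] N(2)[of N j] G_pos[of N] chain_weight_pos[OF that, of 0 "N - 1"]
    by (simp add: r_def b_def)
  have "summable (\<lambda>m. C * inverse (real (m + N) ^ 2))"
    by (intro summable_mult summable_ignore_initial_segment[of "\<lambda>m. inverse (real m ^ 2)"]
        inverse_power_summable) simp
  then have summ: "summable (\<lambda>m. C / real (m + N) ^ 2)" by (simp add: field_simps)
  obtain c where c: "c > 0" "\<forall>j\<le>k. (\<lambda>m. r m j) \<longlonglongrightarrow> c"
    using perturbed_stochastic_convergence[of k r "\<lambda>m. P (m + N)" \<delta> "\<lambda>m. C / real (m + N) ^ 2",
        OF r_rec r_pos P_nonneg N(5) \<delta> N(3) N(4) summ]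
    by auto
  \<comment> \<open>Multiplying by \<open>W\<close> undoes the normalisation, since \<open>W\<close>
    tends to \<open>right_vec\<close>.\<close>
  have "(\<lambda>m. r m 0 * W (m + N) 0) \<longlonglongrightarrow> c * ?w 0"
    using c(2) LIMSEQ_ignore_initial_segment[OF expands_tendsto[OF W]] by (intro tendsto_mult) auto
  moreover have "r m 0 * W (m + N) 0 = b (m + N) 0 / G (m + N)" for m
    using N(2)[of "m + N" 0] by (simp add: r_def)
  ultimately have "(\<lambda>m. b (m + N) 0 / G (m + N)) \<longlonglongrightarrow> c * ?w 0" by simp
  then have "(\<lambda>p. b p 0 / G p) \<longlonglongrightarrow> c * ?w 0" by (rule LIMSEQ_offset)
  then have "(\<lambda>n. b (Suc n) 0 / G (Suc n)) \<longlonglongrightarrow> c * ?w 0" by (rule LIMSEQ_Suc)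
  then show ?thesis
    using c(1) right_vec_pos[of 0 k]
    by (intro exI[of _ "c * ?w 0"]) (simp add: b_def G_def)
qed

theorem mainTheorem2:
  fixes k :: nat
  shows "\<exists>\<kappa> :: real.
    (\<lambda>n. real (compacted_count k n)) \<sim>[at_top]
    (\<lambda>n. \<kappa> * fact n * (4 * (cos (pi / (real k + 3)))\<^sup>2) ^ n *
       real n powr (- real k / 2 - 1 / (real k + 3)
         - (1 / 4 - 1 / (real k + 3)) * (1 / (cos (pi / (real k + 3)))\<^sup>2)))"
proof -
  let ?g = "\<lambda>n. fact n * (perron k ^ n * real n powr exponent k)"
  obtain c where c: "c > 0" "(\<lambda>n. real (compacted_count k (Suc n)) / ?g (Suc n)) \<longlonglongrightarrow> c"
    using chain_weight_asymptotics[of k] unfolding compacted_count_eq_chain_weight by blast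
  have "(\<lambda>n. real (compacted_count k n) / ?g n) \<longlonglongrightarrow> c"
    using c(2) by (rule LIMSEQ_imp_Suc)
  \<comment> \<open>As \<open>c\<close> is nonzero, convergence of the quotient amounts to
    asymptotic equivalence.\<close>
  then have "(\<lambda>n. real (compacted_count k n)) \<sim>[at_top] (\<lambda>n. c * ?g n)"
    using c(1) by (intro asymp_equivI'_const) auto
  then show ?thesis
    unfolding perron_def exponent_def angle_def by (intro exI[of _ c]) (simp only: mult.assoc)
qed

end
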